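(* Let $k$ and $K$ be the fields constructed in the context. Then $K/k$ is absolutely $lq$-finite.
   Context: Let $Q$ be a perfect field of characteristic $p>0$, let $X$ and $Z_i^j,Y_i^j$ ($i\ge1$, $j\ge2$; here $j$ is an upper index, not an exponent) be a family algebraically independent over $Q$, and let $k=Q(X,(Z_i^j,Y_i^j)_{i\ge1,j\ge2})$ be the field of rational functions. All $p$-power roots are taken in a fixed algebraic closure of $k$, and $Q(X^{p^{-\infty}})=\bigcup_{n\ge1}Q(X^{p^{-n}})$. Let $(a_n)_{n\ge1}$ be a family of elements of $Q(X^{p^{-\infty}})$ such that $Q(a_n)=Q(X^{p^{-n}})$ for all $n\ge1$. Put $\theta_i^1=a_i$ for $i\ge1$ and $K_1=\bigcup_{i\ge1}k(\theta_i^1)$. For $n\ge2$ define recursively (upper indices of $\theta$ are indices) $$\theta_1^n=(Z_1^n)^{p^{-1}}\theta_2^{n-1}+(Y_1^n)^{p^{-1}},\qquad \theta_i^n=(Z_i^n)^{p^{-1}}\theta_{2i}^{n-1}+(\theta_{i-1}^n)^{p^{-1}}+(Y_i^n)^{p^{-1}}\quad(i\ge2),$$ and $K_n=\bigcup_{i\ge1}K_{n-1}(\theta_i^n)$ (an increasing union of fields). Finally $K=\bigcup_{n\ge1}K_n$, a purely inseparable extension of $k$. A purely inseparable extension $K/L$ is $lq$-finite if for every $n\ge 1$ the field $\{x\in K:x^{p^n}\in L\}$ is a finite extension of $L$; $K/k$ is absolutely $lq$-finite if $K/L$ is $lq$-finite for every intermediate field $k\subseteq L\subseteq K$. *)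

theory Defs
  imports "HOL-Algebra.Algebraic_Closure_Type" "HOL-Algebra.Generated_Fields"
begin

text \<open>
  The ambient algebraic closure is a type \<open>'a\<close> of class \<open>field\<close>. Subfields are subsets of it;
  the notions of \<open>HOL-Algebra\<close> about them are taken in the ring structure of the type.
\<close>

abbreviation ambient :: "'a::field ring" where
  "ambient \<equiv> ring_of_type_algebra"

text \<open>\<open>adjoin F S\<close> is the field \<open>F(S)\<close>.\<close>

abbreviation adjoin :: "'a::field set \<Rightarrow> 'a set \<Rightarrow> 'a set" where
  "adjoin F S \<equiv> generate_field ambient (F \<union> S)"

text \<open>For a field of characteristic \<open>p > 0\<close>: every element is a \<open>p\<close>-th power.\<close>

definition perfect_subfield :: "nat \<Rightarrow> 'a::field set \<Rightarrow> bool" where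
  "perfect_subfield p F \<longleftrightarrow> subfield F ambient \<and> (\<forall>x\<in>F. \<exists>y\<in>F. y ^ p = x)"

text \<open>
  Monomials in variables indexed by \<open>I\<close> are finite multisets over \<open>I\<close>, so
  \<open>\<Sum>m\<in>M. c m * (\<Prod>i\<in>#m. f i)\<close> is the value at \<open>f\<close> of the polynomial with coefficients \<open>c\<close>.
\<close>

definition algebraically_independent ::
    "'a::field set \<Rightarrow> 'i set \<Rightarrow> ('i \<Rightarrow> 'a) \<Rightarrow> bool" where
  "algebraically_independent F I f \<longleftrightarrow>
    (\<forall>M c. finite M \<longrightarrow> (\<forall>m\<in>M. set_mset m \<subseteq> I \<and> c m \<in> F) \<longrightarrow>
       (\<Sum>m\<in>M. c m * (\<Prod>i\<in>#m. f i)) = 0 \<longrightarrow> (\<forall>m\<in>M. c m = 0))"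

text \<open>In characteristic \<open>p\<close> the \<open>p^n\<close>-th root is unique; it exists in an algebraic closure.\<close>

definition pp_root :: "nat \<Rightarrow> nat \<Rightarrow> 'a::field \<Rightarrow> 'a" where
  "pp_root p n x = (THE y. y ^ (p ^ n) = x)"

datatype indet = VX | VZ nat nat | VY nat nat

definition indets :: "indet set" where
  "indets = {VX} \<union> {VZ i j |i j. 1 \<le> i \<and> 2 \<le> j} \<union> {VY i j |i j. 1 \<le> i \<and> 2 \<le> j}"

text \<open>\<open>Z i j\<close> stands for $Z_i^j$, and likewise for \<open>Y\<close> and for \<open>theta\<close> below.\<close>

fun indet_value ::
    "'a \<Rightarrow> (nat \<Rightarrow> nat \<Rightarrow> 'a) \<Rightarrow> (nat \<Rightarrow> nat \<Rightarrow> 'a) \<Rightarrow> indet \<Rightarrow> 'a" where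
  "indet_value X0 Z Y VX = X0"
| "indet_value X0 Z Y (VZ i j) = Z i j"
| "indet_value X0 Z Y (VY i j) = Y i j"

definition base_field ::
    "'a::field set \<Rightarrow> 'a \<Rightarrow> (nat \<Rightarrow> nat \<Rightarrow> 'a) \<Rightarrow> (nat \<Rightarrow> nat \<Rightarrow> 'a) \<Rightarrow> 'a set" where
  "base_field Q X0 Z Y = adjoin Q (indet_value X0 Z Y ` indets)"

definition perfect_hull_X :: "nat \<Rightarrow> 'a::field set \<Rightarrow> 'a \<Rightarrow> 'a set" where
  "perfect_hull_X p Q X0 = (\<Union>n\<in>{1..}. adjoin Q {pp_root p n X0})"

text \<open>Both indices start at 1; the values at index 0 are dummies.\<close>

fun theta ::
    "nat \<Rightarrow> (nat \<Rightarrow> 'a::field) \<Rightarrow> (nat \<Rightarrow> nat \<Rightarrow> 'a) \<Rightarrow> (nat \<Rightarrow> nat \<Rightarrow> 'a) \<Rightarrow> nat \<Rightarrow> nat \<Rightarrow> 'a"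
where
  "theta p a Z Y i 0 = 0"
| "theta p a Z Y i (Suc 0) = a i"
| "theta p a Z Y 0 (Suc (Suc n)) = 0"
| "theta p a Z Y (Suc 0) (Suc (Suc n)) =
     pp_root p 1 (Z 1 (n + 2)) * theta p a Z Y 2 (Suc n) + pp_root p 1 (Y 1 (n + 2))"
| "theta p a Z Y (Suc (Suc i)) (Suc (Suc n)) =
     pp_root p 1 (Z (i + 2) (n + 2)) * theta p a Z Y (2 * (i + 2)) (Suc n)
     + pp_root p 1 (theta p a Z Y (Suc i) (Suc (Suc n)))
     + pp_root p 1 (Y (i + 2) (n + 2))"

lemma theta_first: "theta p a Z Y i 1 = a i"
  by simp

lemma theta_1:
  "2 \<le> n \<Longrightarrow> theta p a Z Y 1 n =
     pp_root p 1 (Z 1 n) * theta p a Z Y 2 (n - 1) + pp_root p 1 (Y 1 n)"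
  by (cases n; cases "n - 1") auto

lemma theta_rec:
  "2 \<le> n \<Longrightarrow> 2 \<le> i \<Longrightarrow> theta p a Z Y i n =
     pp_root p 1 (Z i n) * theta p a Z Y (2 * i) (n - 1)
     + pp_root p 1 (theta p a Z Y (i - 1) n) + pp_root p 1 (Y i n)"
  by (cases n; cases "n - 1"; cases i; cases "i - 1") auto

primrec tower ::
    "'a::field set \<Rightarrow> nat \<Rightarrow> (nat \<Rightarrow> 'a) \<Rightarrow> (nat \<Rightarrow> nat \<Rightarrow> 'a) \<Rightarrow> (nat \<Rightarrow> nat \<Rightarrow> 'a) \<Rightarrow> nat \<Rightarrow> 'a set"
where
  "tower k p a Z Y 0 = k"
| "tower k p a Z Y (Suc n) =
     (\<Union>i\<in>{1..}. adjoin (tower k p a Z Y n) {theta p a Z Y i (Suc n)})"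

definition tower_union ::
    "'a::field set \<Rightarrow> nat \<Rightarrow> (nat \<Rightarrow> 'a) \<Rightarrow> (nat \<Rightarrow> nat \<Rightarrow> 'a) \<Rightarrow> (nat \<Rightarrow> nat \<Rightarrow> 'a) \<Rightarrow> 'a set"
where
  "tower_union k p a Z Y = (\<Union>n\<in>{1..}. tower k p a Z Y n)"

definition purely_inseparable :: "nat \<Rightarrow> 'a::field set \<Rightarrow> 'a set \<Rightarrow> bool" where
  "purely_inseparable p L K \<longleftrightarrow>
     subfield L ambient \<and> subfield K ambient \<and> L \<subseteq> K \<and> (\<forall>x\<in>K. \<exists>m. x ^ (p ^ m) \<in> L)"

definition lq_finite :: "nat \<Rightarrow> 'a::field set \<Rightarrow> 'a set \<Rightarrow> bool" where
  "lq_finite p L K \<longleftrightarrow> purely_inseparable p L K \<and>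
     (\<forall>n\<ge>1. ring.finite_dimension ambient L {x \<in> K. x ^ (p ^ n) \<in> L})"

definition absolutely_lq_finite :: "nat \<Rightarrow> 'a::field set \<Rightarrow> 'a set \<Rightarrow> bool" where
  "absolutely_lq_finite p k K \<longleftrightarrow>
     (\<forall>L. subfield L ambient \<longrightarrow> k \<subseteq> L \<longrightarrow> L \<subseteq> K \<longrightarrow> lq_finite p L K)"

end

theory Submission
  imports Defs
begin

text \<open>
  Write \<open>K n\<close> for the \<open>n\<close>-th field of the tower, \<open>K\<close> for its union and \<open>T i j\<close> for the generators,
  so that \<open>T i 1 = a i\<close> and \<open>T i j ^ p = Z i j * T (2 * i) (j - 1) ^ p + T (i - 1) j + Y i j\<close> in the
  rows \<open>j \<ge> 2\<close>, where \<open>T 0 j = 0\<close>. Over \<open>K n\<close> the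
  generator \<open>T i j\<close> with \<open>j > n\<close> has exponent \<open>2^(j - n - 1) * i\<close>, its \<^emph>\<open>weight\<close>; in particular only
  finitely many generators have weight at most \<open>m\<close>. Let \<open>M n m\<close> be the finite extension of
  \<open>K n\<close> that they generate. Two facts about these fields give the theorem.

  First, every \<open>x\<close> in \<open>K\<close> with \<open>x^(p^m)\<close> in \<open>K n\<close> lies in \<open>M n m\<close> (\<open>exponent_bound\<close>). By induction on \<open>m\<close>
  this is a statement about \<open>p\<close>-th roots of elements of \<open>M n m\<close>. Order the generators by weight, then
  by row, and let \<open>T = T i j\<close> be the last one in \<open>x\<close>, so that \<open>x\<close> is a polynomial of degree
  below \<open>p\<close> in \<open>T\<close>, with earlier coefficients. Suppose its weight is above \<open>m + 1\<close>. In row \<open>n + 1\<close>, \<open>T\<close>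
  needs a deeper root of a certain indeterminate than everything else in sight. In a later row,
  \<open>x^p\<close> is a polynomial in \<open>T^p = Z c + b + Y\<close>, where \<open>Z\<close> and \<open>Y\<close> are indeterminates that are
  independent of all earlier generators, and \<open>c = T (2 * i) (j - 1) ^ p\<close> is not in \<open>M n m\<close>, as its
  weight is too large. Differentiating by \<open>Z\<close> and by \<open>Y\<close> then shows that a nonconstant polynomial in
  \<open>Z c + b + Y\<close> cannot lie in \<open>M n m\<close> (\<open>two_variables\<close>). Either way, \<open>x\<close> does not involve \<open>T\<close>.

  Secondly, an intermediate field \<open>L\<close> of unbounded exponent over \<open>K n\<close> contains \<open>K (n + 1)\<close>
  (\<open>unbounded_absorbs\<close>): if \<open>x\<close> in \<open>L\<close> has a large exponent \<open>e\<close>, then \<open>x\<close> lies in \<open>M n e\<close>, and in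
  \<open>x^(p^t)\<close> with \<open>t\<close> about \<open>e / 2\<close> only generators of row \<open>n + 1\<close> survive; but these form a chain of
  extensions of degree \<open>p\<close>, so that such a power generates a long piece of the chain.

  Hence an intermediate field \<open>L\<close> either is \<open>K\<close>, or contains some \<open>K n\<close> over which it has bounded
  exponent \<open>s\<close>. In the latter case every \<open>x\<close> in \<open>K\<close> with \<open>x^(p^m)\<close> in \<open>L\<close> lies in the finite
  extension \<open>M n (m + s)\<close> of \<open>K n\<close>.
\<close>

section \<open>Subfields of the ambient field\<close>

abbreviation gen :: "'a::field set \<Rightarrow> 'a set" where
  "gen S \<equiv> generate_field ambient S"

lemma subfieldI_ambient:
  fixes F :: "'a::field set"
  assumes "1 \<in> F" "\<And>x y. x \<in> F \<Longrightarrow> y \<in> F \<Longrightarrow> x - y \<in> F"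
    "\<And>x y. x \<in> F \<Longrightarrow> y \<in> F \<Longrightarrow> x * y \<in> F" "\<And>x. x \<in> F \<Longrightarrow> x \<noteq> 0 \<Longrightarrow> inverse x \<in> F"
  shows "subfield F ambient"
proof -
  interpret A: field "ambient :: 'a ring" by (rule field_from_type_algebra)
  have op: "carrier ambient = (UNIV :: 'a set)" "\<zero>\<^bsub>ambient\<^esub> = (0::'a)" "\<one>\<^bsub>ambient\<^esub> = (1::'a)"
    "x \<oplus>\<^bsub>ambient\<^esub> y = x + y" "x \<otimes>\<^bsub>ambient\<^esub> y = x * y" for x y :: 'a
    by (simp_all add: ring_of_type_algebra_def)
  have neg: "\<ominus>\<^bsub>ambient\<^esub> x = - x" for x :: 'a
    by (rule A.minus_equality) (simp_all add: op)
  have inv: "inv\<^bsub>ambient\<^esub> x = inverse x" if "x \<noteq> 0" for x :: 'a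
    by (rule A.inv_char) (simp_all add: op that)
  have z: "0 \<in> F" using assms(2)[OF assms(1) assms(1)] by simp
  have m: "- x \<in> F" if "x \<in> F" for x using assms(2)[OF z that] by simp
  have a: "x + y \<in> F" if "x \<in> F" "y \<in> F" for x y using assms(2)[OF that(1) m[OF that(2)]] by simp
  have "subring F (ambient :: 'a ring)"
    by (rule A.subringI) (use assms m a in \<open>auto simp: op neg\<close>)
  then show ?thesis
    by (rule A.subfieldI') (use assms(4) in \<open>auto simp: op inv\<close>)
qed

lemma
  fixes F :: "'a::field set"
  assumes "subfield F ambient"
  shows sf_0: "0 \<in> F" and sf_1: "1 \<in> F"
    and sf_uminus: "\<And>x. x \<in> F \<Longrightarrow> - x \<in> F"
    and sf_add: "\<And>x y. x \<in> F \<Longrightarrow> y \<in> F \<Longrightarrow> x + y \<in> F"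
    and sf_mult: "\<And>x y. x \<in> F \<Longrightarrow> y \<in> F \<Longrightarrow> x * y \<in> F"
    and sf_inverse: "\<And>x. x \<in> F \<Longrightarrow> inverse x \<in> F"
proof -
  interpret A: field "ambient :: 'a ring" by (rule field_from_type_algebra)
  have op: "\<zero>\<^bsub>ambient\<^esub> = (0::'a)" "\<one>\<^bsub>ambient\<^esub> = (1::'a)"
    "x \<oplus>\<^bsub>ambient\<^esub> y = x + y" "x \<otimes>\<^bsub>ambient\<^esub> y = x * y" for x y :: 'a
    by (simp_all add: ring_of_type_algebra_def)
  have neg: "\<ominus>\<^bsub>ambient\<^esub> x = - x" for x :: 'a
    by (rule A.minus_equality) (simp_all add: ring_of_type_algebra_def)
  have inv: "inv\<^bsub>ambient\<^esub> x = inverse x" if "x \<noteq> 0" for x :: 'a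
    by (rule A.inv_char) (simp_all add: ring_of_type_algebra_def that)
  note S = subringE[OF subfieldE(1)[OF assms], unfolded op neg]
  show "0 \<in> F" "1 \<in> F" "\<And>x. x \<in> F \<Longrightarrow> - x \<in> F"
    "\<And>x y. x \<in> F \<Longrightarrow> y \<in> F \<Longrightarrow> x + y \<in> F" "\<And>x y. x \<in> F \<Longrightarrow> y \<in> F \<Longrightarrow> x * y \<in> F"
    using S(2,3,5,6,7) by auto
  show "inverse x \<in> F" if "x \<in> F" for x
  proof (cases "x = 0")
    case False
    then show ?thesis
      using A.subfield_m_inv(1)[OF assms, of x] that by (simp add: op inv[OF False])
  qed (use that in auto)
qed

lemma sf_diff: "subfield F ambient \<Longrightarrow> x \<in> F \<Longrightarrow> y \<in> F \<Longrightarrow> x - y \<in> F"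
  for x :: "'a::field"
  using sf_add[of F x "- y"] sf_uminus[of F y] by simp

lemma sf_divide: "subfield F ambient \<Longrightarrow> x \<in> F \<Longrightarrow> y \<in> F \<Longrightarrow> x / y \<in> F"
  for x :: "'a::field"
  by (simp add: divide_inverse sf_mult sf_inverse)

lemma sf_power: "subfield F ambient \<Longrightarrow> x \<in> F \<Longrightarrow> x ^ n \<in> F"
  for x :: "'a::field"
  by (induction n) (auto intro: sf_1 sf_mult)

lemma sf_of_nat: "subfield F ambient \<Longrightarrow> (of_nat n :: 'a::field) \<in> F"
  by (induction n) (auto intro: sf_0 sf_1 sf_add)

lemma sf_sum: "subfield F ambient \<Longrightarrow> (\<And>i. i \<in> A \<Longrightarrow> f i \<in> F) \<Longrightarrow> sum f A \<in> F"
  for f :: "'b \<Rightarrow> 'a::field"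
  by (induction A rule: infinite_finite_induct) (auto intro: sf_0 sf_add)

lemmas sf_closed = sf_0 sf_1 sf_uminus sf_add sf_mult sf_inverse sf_diff sf_divide sf_power
  sf_of_nat sf_sum

lemma sf_Int: "subfield F ambient \<Longrightarrow> subfield G ambient \<Longrightarrow> subfield (F \<inter> G) ambient"
  for F :: "'a::field set"
  by (rule subfieldI_ambient) (auto simp: sf_1 sf_diff sf_mult sf_inverse)

lemma sf_UN_chain:
  fixes F :: "nat \<Rightarrow> 'a::field set"
  assumes "\<And>n. subfield (F n) ambient" "\<And>n. F n \<subseteq> F (Suc n)"
  shows "subfield (\<Union>n. F n) ambient"
proof -
  have mono: "F m \<subseteq> F n" if "m \<le> n" for m n
    using that assms(2) by (rule lift_Suc_mono_le[rotated])
  have two: "\<exists>l. x \<in> F l \<and> y \<in> F l" if "x \<in> F m" "y \<in> F n" for x y m n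
    using that mono[of m "max m n"] mono[of n "max m n"] by (meson in_mono max.cobounded1 max.cobounded2)
  show ?thesis
  proof (rule subfieldI_ambient)
    fix x y assume "x \<in> (\<Union>n. F n)" "y \<in> (\<Union>n. F n)"
    then obtain l where "x \<in> F l" "y \<in> F l" using two by blast
    then show "x - y \<in> (\<Union>n. F n)" "x * y \<in> (\<Union>n. F n)"
      by (auto intro: sf_diff[OF assms(1)] sf_mult[OF assms(1)])
  qed (auto intro: sf_1[OF assms(1)] sf_inverse[OF assms(1)])
qed

lemma gen_subfield: "subfield (gen S) ambient" for S :: "'a::field set"
  by (rule field.generate_field_is_subfield[OF field_from_type_algebra])
    (simp add: ring_of_type_algebra_def)

lemma gen_incl: "S \<subseteq> gen S" for S :: "'a::field set"
  by (auto intro: generate_field.incl)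

lemma gen_least: "subfield F ambient \<Longrightarrow> S \<subseteq> F \<Longrightarrow> gen S \<subseteq> F" for F :: "'a::field set"
  by (rule field.generate_field_min_subfield1[OF field_from_type_algebra])
    (simp_all add: ring_of_type_algebra_def)

lemma gen_mono: "S \<subseteq> S' \<Longrightarrow> gen S \<subseteq> gen S'" for S :: "'a::field set"
  by (meson gen_incl gen_least gen_subfield order_trans)

lemmas gen_closed = sf_closed[OF gen_subfield]

section \<open>Purely inseparable extensions of exponent one\<close>

definition poly_over :: "'a::field set \<Rightarrow> 'a poly \<Rightarrow> bool" where
  "poly_over F f \<longleftrightarrow> (\<forall>i. coeff f i \<in> F)"

lemma poly_overD: "poly_over F f \<Longrightarrow> coeff f i \<in> F"
  by (simp add: poly_over_def)

lemma poly_over_mono: "poly_over F f \<Longrightarrow> F \<subseteq> G \<Longrightarrow> poly_over G f"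
  by (auto simp: poly_over_def)

lemma poly_over_pCons:
  assumes "subfield F ambient"
  shows "poly_over F (pCons c f) \<longleftrightarrow> c \<in> F \<and> poly_over F f"
  unfolding poly_over_def by (auto simp: coeff_pCons split: nat.splits)

lemma poly_over_0: "subfield F ambient \<Longrightarrow> poly_over F 0"
  by (simp add: poly_over_def sf_0)

lemma
  assumes F: "subfield F ambient"
  shows poly_over_add: "poly_over F f \<Longrightarrow> poly_over F g \<Longrightarrow> poly_over F (f + g)"
    and poly_over_diff: "poly_over F f \<Longrightarrow> poly_over F g \<Longrightarrow> poly_over F (f - g)"
    and poly_over_smult: "c \<in> F \<Longrightarrow> poly_over F f \<Longrightarrow> poly_over F (smult c f)"
    and poly_over_mult: "poly_over F f \<Longrightarrow> poly_over F g \<Longrightarrow> poly_over F (f * g)"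
    and poly_over_const: "c \<in> F \<Longrightarrow> poly_over F [:c:]"
  by (auto simp: poly_over_def coeff_mult coeff_pCons sf_0[OF F]
      intro!: sf_add[OF F] sf_diff[OF F] sf_mult[OF F] sf_sum[OF F] split: nat.splits)

lemma poly_over_monom: "subfield F ambient \<Longrightarrow> c \<in> F \<Longrightarrow> poly_over F (monom c n)"
  by (auto simp: poly_over_def sf_0)

lemma poly_over_mod:
  assumes F: "subfield F ambient" and "poly_over F g" "poly_over F f"
  shows "poly_over F (g mod f)"
proof (cases "f = 0")
  case True
  then show ?thesis using assms by simp
next
  case False
  show ?thesis
    using assms(2)
  proof (induction g)
    case 0
    then show ?case by (simp add: poly_over_0[OF F])
  next
    case (pCons c g)
    have *: "poly_over F (pCons c (g mod f))"
      using pCons by (simp add: poly_over_pCons[OF F])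
    show ?case
      unfolding mod_pCons[OF False] Let_def
      by (intro poly_over_diff[OF F] poly_over_smult[OF F] sf_divide[OF F] * assms poly_overD)
  qed
qed

text \<open>The first two terms, from the top, of the Taylor expansion of \<open>d\<close> at \<open>\<alpha>\<close>.\<close>

lemma coeff_pcompose_shift:
  fixes d :: "'a::field poly"
  assumes "degree d \<le> Suc l"
  shows "coeff (pcompose d [:\<alpha>, 1:]) (Suc l) = coeff d (Suc l)"
    and "coeff (pcompose d [:\<alpha>, 1:]) l = of_nat (Suc l) * \<alpha> * coeff d (Suc l) + coeff d l"
proof -
  have "\<forall>l. degree d \<le> Suc l \<longrightarrow> coeff (pcompose d [:\<alpha>, 1:]) (Suc l) = coeff d (Suc l)
     \<and> coeff (pcompose d [:\<alpha>, 1:]) l = of_nat (Suc l) * \<alpha> * coeff d (Suc l) + coeff d l"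
  proof (induction d)
    case (pCons c d)
    show ?case
    proof (intro allI impI)
      fix l
      assume deg: "degree (pCons c d) \<le> Suc l"
      show "coeff (pcompose (pCons c d) [:\<alpha>, 1:]) (Suc l) = coeff (pCons c d) (Suc l)
        \<and> coeff (pcompose (pCons c d) [:\<alpha>, 1:]) l
          = of_nat (Suc l) * \<alpha> * coeff (pCons c d) (Suc l) + coeff (pCons c d) l"
      proof (cases l)
        case 0
        then have "degree d = 0" using deg by (auto split: if_splits)
        then obtain e where "d = [:e:]" by (rule degree_eq_zeroE)
        then show ?thesis using 0 by (simp add: pcompose_pCons)
      next
        case (Suc m)
        then have dm: "degree d \<le> Suc m" using deg by (auto split: if_splits)
        have z: "coeff (pcompose d [:\<alpha>, 1:]) (Suc (Suc m)) = 0"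
          by (rule coeff_eq_0) (use dm degree_pcompose[of d "[:\<alpha>, 1:]"] in simp)
        have zd: "coeff d (Suc (Suc m)) = 0"
          by (rule coeff_eq_0) (use dm in simp)
        show ?thesis
          using pCons.IH dm z zd
          by (simp add: pcompose_pCons Suc coeff_pCons algebra_simps split: nat.splits)
      qed
    qed
  qed simp
  then show "coeff (pcompose d [:\<alpha>, 1:]) (Suc l) = coeff d (Suc l)"
    and "coeff (pcompose d [:\<alpha>, 1:]) l = of_nat (Suc l) * \<alpha> * coeff d (Suc l) + coeff d l"
    using assms by blast+
qed

locale char_p =
  fixes p :: nat and ty :: "'a::field itself"
  assumes p_pos: "p > 0" and CHAR_p: "CHAR('a) = p"
begin

lemma prime_p: "prime p"
  using prime_CHAR_semidom[where 'a = 'a] p_pos CHAR_p by simp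

lemma p_ge_2: "p \<ge> 2"
  using prime_p by (rule prime_ge_2_nat)

lemma frob_add: "(x + y) ^ p ^ n = x ^ p ^ n + (y :: 'a) ^ p ^ n"
  using prime_p CHAR_p by (intro freshmans_dream') auto

lemma frob_diff: "(x - y) ^ p ^ n = x ^ p ^ n - (y :: 'a) ^ p ^ n"
  using frob_add[of "x - y" y n] by (simp add: algebra_simps)

lemma frob_sum: "(\<Sum>i\<in>A. f i) ^ p ^ n = (\<Sum>i\<in>A. (f i :: 'a) ^ p ^ n)"
  using prime_p CHAR_p by (intro freshmans_dream_sum') auto

lemma frob_inj: "x = y" if "x ^ p ^ n = (y :: 'a) ^ p ^ n"
  using frob_diff[of x y n] that p_pos by simp

lemma frob_add1: "(x + y) ^ p = x ^ p + (y :: 'a) ^ p"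
  using frob_add[of x y 1] by simp

lemma frob_sum1: "(\<Sum>i\<in>A. f i) ^ p = (\<Sum>i\<in>A. (f i :: 'a) ^ p)"
  using frob_sum[of f A 1] by simp

lemma pow_Suc: "(x :: 'a) ^ p ^ Suc n = (x ^ p) ^ p ^ n" "(x :: 'a) ^ p ^ Suc n = (x ^ p ^ n) ^ p"
  by (simp_all add: power_mult[symmetric] mult.commute)

lemma pow_add: "(x :: 'a) ^ p ^ (m + n) = (x ^ p ^ m) ^ p ^ n"
  by (simp add: power_mult[symmetric] power_add)

lemma sf_root: 
  fixes F :: "'a set"
  assumes F: "subfield F ambient"
  shows "subfield {x. x ^ p ^ n \<in> F} ambient"
  by (rule subfieldI_ambient)
    (auto simp: frob_diff power_mult_distrib power_inverse sf_1[OF F]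
      intro: sf_diff[OF F] sf_mult[OF F] sf_inverse[OF F])

lemma gen_root:
  fixes F :: "'a set"
  assumes "subfield F ambient" "\<And>s. s \<in> S \<Longrightarrow> s ^ p ^ n \<in> F" "x \<in> gen S"
  shows "x ^ p ^ n \<in> F"
  using gen_least[OF sf_root[OF assms(1)], of S n] assms(2,3) by blast

lemma of_nat_neq_0: "(of_nat n :: 'a) \<noteq> 0" if "0 < n" "n < p"
  using that CHAR_p by (auto simp: of_nat_eq_0_iff_char_dvd dest: dvd_imp_le)

lemma root_poly: "[:- T, 1:] ^ p = monom 1 p - [:(T::'a) ^ p:]"
proof -
  have "prime CHAR('a poly)" "CHAR('a poly) = p"
    using prime_p CHAR_p by simp_all
  then have *: "(f + g) ^ p = f ^ p + g ^ p" for f g :: "'a poly"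
    by (intro freshmans_dream) auto
  have m: "[:0, 1:] ^ p = monom (1::'a) p"
    by (simp add: monom_altdef)
  have c: "[:T:] ^ p = [:T ^ p:]"
    by (induction p) (auto simp: one_pCons)
  have "[:- T, 1:] + [:T:] = [:0, 1:]"
    by simp
  with *[of "[:- T, 1:]" "[:T:]"] show ?thesis
    by (simp add: m c algebra_simps)
qed

text \<open>A nonzero polynomial over \<open>F\<close> of least degree \<open>d\<close> that vanishes at \<open>T\<close> divides
  \<open>X^p - T^p = (X - T)^p\<close>, hence is \<open>c (X - T)^d\<close>; if \<open>0 < d < p\<close>, its coefficient of \<open>X^(d - 1)\<close> shows
  that \<open>T\<close> lies in \<open>F\<close>. So \<open>T\<close> has degree \<open>p\<close> over \<open>F\<close>.\<close>

theorem p_independent: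
  fixes F :: "'a set"
  assumes F: "subfield F ambient" and T: "T \<notin> F" "T ^ p \<in> F"
    and "poly_over F f" "degree f < p" "poly f T = 0"
  shows "f = 0"
proof (rule ccontr)
  assume "f \<noteq> 0"
  define P where "P = (\<lambda>g. poly_over F g \<and> g \<noteq> 0 \<and> poly g T = 0)"
  have "P f" using assms \<open>f \<noteq> 0\<close> by (simp add: P_def)
  define g where "g = arg_min degree P"
  have Pg: "P g" and min: "\<And>h. P h \<Longrightarrow> degree g \<le> degree h"
    using arg_min_nat_lemma[of P f degree, OF \<open>P f\<close>] by (auto simp: g_def)
  have g: "poly_over F g" "g \<noteq> 0" "poly g T = 0"
    using Pg by (auto simp: P_def)
  have dg: "degree g < p"
    using min[OF \<open>P f\<close>] assms by simp
  define h where "h = [:- T, 1:] ^ p"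
  have h: "poly_over F h"
    unfolding h_def root_poly by (intro poly_over_diff poly_over_monom poly_over_const F T sf_1)
  have "poly h T = 0" using p_pos by (simp add: h_def)
  then have root: "poly (h mod g) T = 0"
    using g(3) by (simp add: minus_mult_div_eq_mod[symmetric])
  have "h mod g = 0"
  proof (rule ccontr)
    assume nz: "h mod g \<noteq> 0"
    then have "P (h mod g)"
      using root poly_over_mod[OF F h g(1)] by (simp add: P_def)
    then show False
      using min degree_mod_less'[OF g(2) nz] by fastforce
  qed
  then obtain q where hq: "h = g * q" by (metis mod_0_imp_dvd dvdE)
  have "h \<noteq> 0" by (simp add: h_def)
  then have q0: "q \<noteq> 0" using hq by auto
  have "order T h = order T g + order T q"
    using order_mult[of g q T] \<open>h \<noteq> 0\<close> hq by simp
  moreover have "order T h = p" unfolding h_def by (rule order_power_n_n)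
  moreover have "degree h = degree g + degree q" "degree h = p"
    using degree_mult_eq[OF g(2) q0] degree_linear_power[of "- T" p] by (simp_all add: hq[symmetric] h_def)
  moreover have "order T g \<le> degree g" "order T q \<le> degree q"
    using g(2) q0 by (simp_all add: order_degree)
  ultimately have ord: "order T g = degree g" by simp
  define d where "d = degree g"
  have "[:- T, 1:] ^ d dvd g"
    using order_1[of T g] ord by (simp add: d_def)
  then obtain r where r: "g = [:- T, 1:] ^ d * r" by (rule dvdE)
  then have "r \<noteq> 0" using g(2) by auto
  then have "degree r = 0"
    using degree_mult_eq[of "[:- T, 1:] ^ d" r]
    by (simp add: r[symmetric] d_def[symmetric] degree_linear_power)
  then obtain c where "r = [:c:]" by (rule degree_eq_zeroE)
  then have gc: "g = smult c ([:- T, 1:] ^ d)" using r by simp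
  then have "c \<noteq> 0" using g(2) by auto
  have "d > 0"
  proof (rule ccontr)
    assume "\<not> d > 0"
    then show False using gc g(3) \<open>c \<noteq> 0\<close> by simp
  qed
  moreover have "d choose (d - Suc 0) = d"
    using \<open>d > 0\<close> by (cases d) simp_all
  ultimately have "coeff g (d - 1) = c * (of_nat d * (- T))"
    unfolding gc by (simp add: coeff_linear_poly_power)
  moreover have "coeff g d = c"
    unfolding gc by (simp add: coeff_linear_power)
  ultimately have "- (coeff g (d - 1) / (coeff g d * of_nat d)) = T"
    using \<open>c \<noteq> 0\<close> of_nat_neq_0[OF \<open>d > 0\<close>] dg by (simp add: d_def field_simps)
  moreover have "- (coeff g (d - 1) / (coeff g d * of_nat d)) \<in> F"
    by (intro sf_uminus sf_divide sf_mult sf_of_nat F poly_overD[OF g(1)])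
  ultimately show False using T by simp
qed

lemma p_independent_const:
  fixes F R :: "'a set"
  assumes F: "subfield F ambient" and "T \<notin> F" "T ^ p \<in> F" and "R \<subseteq> F"
    and f: "poly_over R f" "degree f < p" "poly f T \<in> F"
  shows "poly f T \<in> R"
proof -
  have "poly_over F f" using f(1) \<open>R \<subseteq> F\<close> by (rule poly_over_mono)
  then have "f - [:poly f T:] = 0"
    by (intro p_independent[OF F assms(2,3)] poly_over_diff poly_over_const F f)
      (use f(2) p_pos in \<open>auto simp: degree_diff_less\<close>)
  from arg_cong[OF this, of "\<lambda>g. coeff g 0"] have "coeff f 0 = poly f T" by simp
  then show ?thesis using poly_overD[OF f(1), of 0] by simp
qed

lemma adjoin_root_poly:
  fixes F :: "'a set"
  assumes F: "subfield F ambient" and T: "T ^ p \<in> F" and x: "x \<in> gen (F \<union> {T})"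
  obtains f where "poly_over F f" "degree f < p" "x = poly f T"
proof -
  define h where "h = monom 1 p - [:T ^ p:]"
  have dh: "degree h = p" "h \<noteq> 0"
    unfolding h_def root_poly[symmetric] by (simp_all add: degree_linear_power)
  have h: "poly_over F h"
    unfolding h_def by (intro poly_over_diff poly_over_monom poly_over_const F T sf_1)
  have hT: "poly h T = 0" by (simp add: h_def poly_monom)
  define R where "R = {poly f T |f. poly_over F f}"
  have mult: "x * y \<in> R" if "x \<in> R" "y \<in> R" for x y
    using that poly_over_mult[OF F] unfolding R_def by clarify (metis poly_mult)
  have FR: "F \<subseteq> R"
  proof
    fix c assume "c \<in> F"
    then have "poly_over F [:c:]" "c = poly [:c:] T" using poly_over_const[OF F] by auto
    then show "c \<in> R" unfolding R_def by blast
  qed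
  have TR: "T \<in> R"
  proof -
    have "poly_over F [:0, 1:]" "T = poly [:0, 1:] T"
      using F by (auto simp: poly_over_pCons poly_over_0 sf_0 sf_1)
    then show ?thesis unfolding R_def by blast
  qed
  have powR: "x ^ n \<in> R" if "x \<in> R" for x n
    by (induction n) (use FR sf_1[OF F] mult that in auto)
  have powF: "x ^ p \<in> F" if xR: "x \<in> R" for x
  proof -
    obtain f where f: "poly_over F f" "x = poly f T" using xR unfolding R_def by blast
    have "x ^ p = (\<Sum>i\<le>degree f. coeff f i ^ p * (T ^ p) ^ i)"
      by (simp add: f(2) poly_altdef frob_sum1 power_mult_distrib power_mult[symmetric] mult.commute)
    also have "\<dots> \<in> F"
      by (intro sf_sum sf_mult sf_power F T poly_overD[OF f(1)])
    finally show ?thesis .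
  qed
  have "subfield R ambient"
  proof (rule subfieldI_ambient)
    show "1 \<in> R" using FR sf_1[OF F] by blast
    show "x - y \<in> R" if "x \<in> R" "y \<in> R" for x y
      using that poly_over_diff[OF F] unfolding R_def by clarify (metis poly_diff)
    show "inverse x \<in> R" if "x \<in> R" "x \<noteq> 0" for x
    proof -
      have "inverse x = x ^ (p - 1) * inverse (x ^ p)"
        using that(2) p_pos by (cases p) (auto simp: field_simps)
      also have "\<dots> \<in> R"
        using FR sf_inverse[OF F powF[OF that(1)]] by (intro mult powR that) auto
      finally show ?thesis .
    qed
  qed (rule mult)
  then have "x \<in> R"
    using gen_least[of R "F \<union> {T}"] FR TR x by blast
  then obtain f where f: "poly_over F f" "x = poly f T" unfolding R_def by blast
  show ?thesis
  proof
    show "poly_over F (f mod h)" by (rule poly_over_mod[OF F f(1) h])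
    show "degree (f mod h) < p"
      using degree_mod_less[OF dh(2), of f] dh(1) p_pos by auto
    show "x = poly (f mod h) T"
      using hT f(2) by (simp add: minus_mult_div_eq_mod[symmetric])
  qed
qed

text \<open>If \<open>T\<close> were not in \<open>L\<close>, it would still have degree \<open>p\<close> over \<open>L\<close>, while \<open>y\<close> in \<open>L\<close> is a
  nonconstant polynomial of degree below \<open>p\<close> in \<open>T\<close>.\<close>

lemma generator_recovered:
  fixes F L :: "'a set"
  assumes F: "subfield F ambient" and L: "subfield L ambient" "F \<subseteq> L"
    and T: "T ^ p \<in> F" and y: "y \<in> gen (F \<union> {T})" "y \<in> L" "y \<notin> F"
  shows "T \<in> L"
proof (rule ccontr)
  assume TL: "T \<notin> L"
  obtain f where f: "poly_over F f" "degree f < p" "y = poly f T"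
    using adjoin_root_poly[OF F T y(1)] .
  have "T ^ p \<in> L" "poly f T \<in> L" using T L(2) f(3) y(2) by auto
  then have "poly f T \<in> F" using p_independent_const[OF L(1) TL _ L(2) f(1,2)] by blast
  then show False using y(3) f(3) by simp
qed

text \<open>Over \<open>H\<close> one has \<open>d(Z c + b + Y) = c dZ + dY\<close>, so the partial derivatives by \<open>Z\<close> and \<open>Y\<close> of a
  polynomial in \<open>Z c + b + Y\<close> have quotient \<open>c\<close>, while those of an element of \<open>R(Z, Y)\<close> are again in
  \<open>R(Z, Y)\<close>. Instead of differentiating, the proof compares the coefficients of \<open>Y^l\<close> and of
  \<open>Z Y^(l - 1)\<close>, where \<open>l\<close> is the degree of \<open>d\<close>.\<close>

theorem two_variables:
  fixes R H G :: "'a set"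
  assumes R: "subfield R ambient" and H: "subfield H ambient" and G: "subfield G ambient"
    and RH: "R \<subseteq> H" and HG: "H \<subseteq> G"
    and Z: "Z ^ p \<in> R" "Z \<notin> H" "Z \<in> G" and Y: "Y ^ p \<in> R" "Y \<notin> G"
    and c: "c \<in> H" "c \<notin> R" and b: "b \<in> H"
    and d: "poly_over H d" "degree d < p" and u: "poly d (Z * c + b + Y) \<in> gen (R \<union> {Z, Y})"
  shows "degree d = 0"
proof (rule ccontr)
  assume "degree d \<noteq> 0"
  then obtain l where l: "degree d = Suc l" by (cases "degree d") auto
  define \<alpha> where "\<alpha> = Z * c + b"
  have \<alpha>G: "\<alpha> \<in> G"
    unfolding \<alpha>_def using Z(3) c(1) b HG by (intro sf_add sf_mult G) auto
  define e where "e = pcompose d [:\<alpha>, 1:]"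
  define RZ where "RZ = gen (R \<union> {Z})"
  have RZ: "subfield RZ ambient" "R \<subseteq> RZ" "Z \<in> RZ"
    unfolding RZ_def using gen_subfield gen_incl[of "R \<union> {Z}"] by auto
  have RZG: "RZ \<subseteq> G"
    unfolding RZ_def by (rule gen_least) (use G RH HG Z in auto)
  have "R \<union> {Z, Y} \<subseteq> gen (RZ \<union> {Y})"
    using RZ gen_incl[of "RZ \<union> {Y}"] by auto
  then have "poly d (Z * c + b + Y) \<in> gen (RZ \<union> {Y})"
    using u gen_least[OF gen_subfield] by blast
  then obtain f where f: "poly_over RZ f" "degree f < p" "poly d (Z * c + b + Y) = poly f Y"
    using adjoin_root_poly[OF RZ(1), of Y] Y(1) RZ(2) by blast
  have eG: "poly_over G e"
  proof -
    have "poly_over G (pcompose g [:\<alpha>, 1:])" if "poly_over H g" for g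
      using that
    proof (induction g)
      case (pCons a g)
      then have "a \<in> G" "poly_over G (pcompose g [:\<alpha>, 1:])"
        using HG by (auto simp: poly_over_pCons[OF H])
      then show ?case
        unfolding pcompose_pCons
        by (intro poly_over_add poly_over_mult poly_over_const G)
          (auto simp: poly_over_pCons[OF G] poly_over_0[OF G] \<alpha>G sf_1[OF G])
    qed (simp add: poly_over_0[OF G])
    then show ?thesis using d by (simp add: e_def)
  qed
  have "f - e = 0"
  proof (rule p_independent[OF G Y(2)])
    show "Y ^ p \<in> G" using Y(1) RH HG by blast
    show "poly_over G (f - e)"
      using f(1) RZG eG by (intro poly_over_diff G) (auto intro: poly_over_mono)
    show "degree (f - e) < p"
      using f(2) d(2) degree_pcompose[of d "[:\<alpha>, 1:]"] by (intro degree_diff_less) (auto simp: e_def)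
    show "poly (f - e) Y = 0"
      using f(3) by (simp add: e_def poly_pcompose \<alpha>_def algebra_simps)
  qed
  then have fe: "f = e" by simp
  define \<delta> where "\<delta> = coeff d (Suc l)"
  have \<delta>: "\<delta> \<noteq> 0" "\<delta> \<in> H"
    using l poly_overD[OF d(1)] unfolding \<delta>_def by (metis degree_0 leading_coeff_0_iff nat.distinct(1), simp)
  have top: "coeff f (Suc l) = \<delta>" "coeff f l = of_nat (Suc l) * \<alpha> * \<delta> + coeff d l"
    using coeff_pcompose_shift[of d l \<alpha>] l by (simp_all add: fe e_def \<delta>_def)
  have Zp: "Z ^ p \<in> H" using Z(1) RH by blast
  have "\<delta> \<in> RZ" using poly_overD[OF f(1)] top(1) by metis
  then obtain g where g: "poly_over R g" "degree g < p" "\<delta> = poly g Z"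
    using adjoin_root_poly[OF R Z(1)] unfolding RZ_def by blast
  have \<delta>R: "\<delta> \<in> R"
    using p_independent_const[OF H Z(2) Zp RH g(1,2)] g(3) \<delta>(2) by simp
  have "coeff f l \<in> RZ" by (rule poly_overD[OF f(1)])
  then obtain g where g: "poly_over R g" "degree g < p" "coeff f l = poly g Z"
    using adjoin_root_poly[OF R Z(1)] unfolding RZ_def by blast
  define s where "s = of_nat (Suc l) * \<delta>"
  define g' where "g' = [:s * b + coeff d l, s * c:]"
  have sR: "s \<in> R" unfolding s_def by (intro sf_mult sf_of_nat R \<delta>R)
  have s0: "s \<noteq> 0"
    using of_nat_neq_0[of "Suc l"] \<delta>(1) d(2) l by (auto simp: s_def simp del: of_nat_Suc)
  have "g - g' = 0"
  proof (rule p_independent[OF H Z(2) Zp])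
    have "poly_over H g'"
      unfolding g'_def using sR RH c b poly_overD[OF d(1), of l]
      by (auto simp: poly_over_pCons[OF H] poly_over_0[OF H] intro!: sf_add[OF H] sf_mult[OF H])
    then show "poly_over H (g - g')"
      using g(1) RH by (intro poly_over_diff H) (auto intro: poly_over_mono)
    show "degree (g - g') < p"
      using g(2) p_ge_2 by (intro degree_diff_less) (auto simp: g'_def)
    show "poly (g - g') Z = 0"
      using g(3) top(2) by (simp add: g'_def s_def \<alpha>_def algebra_simps)
  qed
  then have "coeff g 1 = s * c" by (simp add: g'_def)
  then have "c = coeff g 1 / s" using s0 by simp
  also have "\<dots> \<in> R" by (intro sf_divide R sR poly_overD[OF g(1)])
  finally show False using c by simp
qed

end

section \<open>Roots of an indeterminate\<close>

locale independent_family = char_p p ty for p and ty :: "'a::field itself" +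
  fixes Q :: "'a set" and I :: "'i set" and f :: "'i \<Rightarrow> 'a"
  assumes Q: "subfield Q ambient" and indep: "algebraically_independent Q I f"
begin

definition graded :: "'i \<Rightarrow> nat \<Rightarrow> nat \<Rightarrow> 'a set" where
  "graded v d r = {(\<Sum>m\<in>M. c m * (\<Prod>i\<in>#m. f i)) |M c.
     finite M \<and> (\<forall>m\<in>M. set_mset m \<subseteq> I \<and> c m \<in> Q \<and> count m v mod d = r)}"

lemma graded_monomial:
  assumes "set_mset m \<subseteq> I" "c \<in> Q" "count m v mod d = r"
  shows "c * (\<Prod>i\<in>#m. f i) \<in> graded v d r"
  unfolding graded_def
  by (rule CollectI, rule exI[of _ "{m}"], rule exI[of _ "\<lambda>_. c"]) (use assms in auto)

lemma graded_0: "0 \<in> graded v d r"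
  unfolding graded_def by (rule CollectI, rule exI[of _ "{}"]) auto

lemma graded_add:
  assumes "x \<in> graded v d r" "y \<in> graded v d r"
  shows "x + y \<in> graded v d r"
proof -
  obtain M c where M: "finite M" "\<And>m. m \<in> M \<Longrightarrow> set_mset m \<subseteq> I"
    "\<And>m. m \<in> M \<Longrightarrow> c m \<in> Q" "\<And>m. m \<in> M \<Longrightarrow> count m v mod d = r"
    "x = (\<Sum>m\<in>M. c m * (\<Prod>i\<in>#m. f i))"
    using assms(1) unfolding graded_def by blast
  obtain N e where N: "finite N" "\<And>m. m \<in> N \<Longrightarrow> set_mset m \<subseteq> I"
    "\<And>m. m \<in> N \<Longrightarrow> e m \<in> Q" "\<And>m. m \<in> N \<Longrightarrow> count m v mod d = r"
    "y = (\<Sum>m\<in>N. e m * (\<Prod>i\<in>#m. f i))"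
    using assms(2) unfolding graded_def by blast
  define c' where "c' = (\<lambda>m. if m \<in> M then c m else 0)"
  define e' where "e' = (\<lambda>m. if m \<in> N then e m else 0)"
  have "x = (\<Sum>m\<in>M \<union> N. c' m * (\<Prod>i\<in>#m. f i))"
    unfolding M(5) by (rule sum.mono_neutral_cong_left) (auto simp: M(1) N(1) c'_def)
  moreover have "y = (\<Sum>m\<in>M \<union> N. e' m * (\<Prod>i\<in>#m. f i))"
    unfolding N(5) by (rule sum.mono_neutral_cong_left) (auto simp: M(1) N(1) e'_def)
  ultimately have eq: "x + y = (\<Sum>m\<in>M \<union> N. (c' m + e' m) * (\<Prod>i\<in>#m. f i))"
    by (simp add: sum.distrib distrib_right)
  have "c' m + e' m \<in> Q" for m
    using M(3) N(3) by (auto simp: c'_def e'_def intro!: sf_add[OF Q] sf_0[OF Q])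
  then show ?thesis
    unfolding graded_def
    by (intro CollectI exI[of _ "M \<union> N"] exI[of _ "\<lambda>m. c' m + e' m"])
      (use M N eq in blast)
qed

lemma graded_sum: "(\<And>i. i \<in> A \<Longrightarrow> g i \<in> graded v d r) \<Longrightarrow> sum g A \<in> graded v d r"
  by (induction A rule: infinite_finite_induct) (auto intro: graded_0 graded_add)

lemma graded_mult:
  assumes "x \<in> graded v d r" "y \<in> graded v d s"
  shows "x * y \<in> graded v d ((r + s) mod d)"
proof -
  obtain M c where M: "finite M" "\<And>m. m \<in> M \<Longrightarrow> set_mset m \<subseteq> I"
    "\<And>m. m \<in> M \<Longrightarrow> c m \<in> Q" "\<And>m. m \<in> M \<Longrightarrow> count m v mod d = r"
    "x = (\<Sum>m\<in>M. c m * (\<Prod>i\<in>#m. f i))"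
    using assms(1) unfolding graded_def by blast
  obtain N e where N: "finite N" "\<And>m. m \<in> N \<Longrightarrow> set_mset m \<subseteq> I"
    "\<And>m. m \<in> N \<Longrightarrow> e m \<in> Q" "\<And>m. m \<in> N \<Longrightarrow> count m v mod d = s"
    "y = (\<Sum>m\<in>N. e m * (\<Prod>i\<in>#m. f i))"
    using assms(2) unfolding graded_def by blast
  have "x * y = (\<Sum>m\<in>M. \<Sum>n\<in>N. (c m * e n) * (\<Prod>i\<in>#m + n. f i))"
    unfolding M(5) N(5) sum_product by (simp add: mult_ac)
  moreover have "(c m * e n) * (\<Prod>i\<in>#m + n. f i) \<in> graded v d ((r + s) mod d)"
    if "m \<in> M" "n \<in> N" for m n
  proof (rule graded_monomial)
    show "set_mset (m + n) \<subseteq> I" using M(2)[OF that(1)] N(2)[OF that(2)] by simp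
    show "c m * e n \<in> Q" using M(3)[OF that(1)] N(3)[OF that(2)] by (rule sf_mult[OF Q])
    show "count (m + n) v mod d = (r + s) mod d"
      using M(4)[OF that(1)] N(4)[OF that(2)] by (metis count_union mod_add_eq)
  qed
  ultimately show ?thesis
    by (simp add: graded_sum)
qed

lemma graded_uminus: "x \<in> graded v d r \<Longrightarrow> - x \<in> graded v d r"
proof -
  assume x: "x \<in> graded v d r"
  obtain M c where M: "finite M" "\<And>m. m \<in> M \<Longrightarrow> set_mset m \<subseteq> I"
    "\<And>m. m \<in> M \<Longrightarrow> c m \<in> Q" "\<And>m. m \<in> M \<Longrightarrow> count m v mod d = r"
    "x = (\<Sum>m\<in>M. c m * (\<Prod>i\<in>#m. f i))"
    using x unfolding graded_def by blast
  have "- x = (\<Sum>m\<in>M. (- c m) * (\<Prod>i\<in>#m. f i))"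
    by (simp add: M(5) sum_negf)
  moreover have "(- c m) * (\<Prod>i\<in>#m. f i) \<in> graded v d r" if "m \<in> M" for m
    by (rule graded_monomial) (use M(2,3,4)[OF that] sf_uminus[OF Q] in simp_all)
  ultimately show ?thesis
    by (simp add: graded_sum)
qed

lemma graded_disjoint:
  assumes "x \<in> graded v d r" "x \<in> graded v d s" "r \<noteq> s"
  shows "x = 0"
proof -
  obtain M c where M: "finite M" "\<And>m. m \<in> M \<Longrightarrow> set_mset m \<subseteq> I"
    "\<And>m. m \<in> M \<Longrightarrow> c m \<in> Q" "\<And>m. m \<in> M \<Longrightarrow> count m v mod d = r"
    "x = (\<Sum>m\<in>M. c m * (\<Prod>i\<in>#m. f i))"
    using assms(1) unfolding graded_def by blast
  obtain N e where N: "finite N" "\<And>m. m \<in> N \<Longrightarrow> set_mset m \<subseteq> I"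
    "\<And>m. m \<in> N \<Longrightarrow> e m \<in> Q" "\<And>m. m \<in> N \<Longrightarrow> count m v mod d = s"
    "x = (\<Sum>m\<in>N. e m * (\<Prod>i\<in>#m. f i))"
    using assms(2) unfolding graded_def by blast
  have disj: "M \<inter> N = {}" using M(4) N(4) assms(3) by blast
  define c' where "c' = (\<lambda>m. if m \<in> M then c m else - e m)"
  have c': "c' m = c m" if "m \<in> M" for m using that by (simp add: c'_def)
  have e': "c' m = - e m" if "m \<in> N" for m using that disj by (auto simp: c'_def)
  have "(\<Sum>m\<in>M \<union> N. c' m * (\<Prod>i\<in>#m. f i)) = x - x"
    unfolding sum.union_disjoint[OF M(1) N(1) disj]
    by (subst (2) N(5), subst (1) M(5)) (simp add: c' e' sum_negf cong: sum.cong)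
  moreover have "set_mset m \<subseteq> I \<and> c' m \<in> Q" if "m \<in> M \<union> N" for m
    using that M(2,3) N(2,3) sf_uminus[OF Q] by (auto simp: c'_def)
  ultimately have "\<forall>m\<in>M \<union> N. c' m = 0"
    using indep[unfolded algebraically_independent_def, THEN spec, THEN spec, of "M \<union> N" c'] M(1) N(1)
    by (simp only: diff_self finite_Un) blast
  then show ?thesis using M(5) c' by simp
qed

lemma indet_neq_0: "v \<in> I \<Longrightarrow> f v \<noteq> 0"
proof
  assume "v \<in> I" "f v = 0"
  then have "\<forall>m\<in>{{#v#}}. (1::'a) = 0"
    using indep[unfolded algebraically_independent_def, rule_format, of "{{#v#}}" "\<lambda>_. 1"]
    by (simp add: sf_1[OF Q])
  then show False by simp
qed

text \<open>Grade polynomials by the exponent of \<open>v\<close> modulo \<open>d\<close>: the elements of the generated field are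
  quotients of polynomials of degree zero, while \<open>v ^ e\<close> is homogeneous of degree \<open>e\<close>.\<close>

lemma indet_power_notin:
  assumes v: "v \<in> I" and e: "0 < e" "e < d"
  shows "f v ^ e \<notin> gen (Q \<union> f ` (I - {v}) \<union> {f v ^ d})"
proof
  assume "f v ^ e \<in> gen (Q \<union> f ` (I - {v}) \<union> {f v ^ d})"
  define P where "P = graded v d 0"
  have one: "1 \<in> P"
    using graded_monomial[of "{#}" 1 v d 0] sf_1[OF Q] by (simp add: P_def)
  have mult: "x * y \<in> P" if "x \<in> P" "y \<in> P" for x y
    using graded_mult[of x v d 0 y 0] that by (simp add: P_def)
  have diff: "x - y \<in> P" if "x \<in> P" "y \<in> P" for x y
    using graded_add[of x v d 0 "- y"] graded_uminus[of y v d 0] that by (simp add: P_def)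
  define E where "E = {g / h |g h. g \<in> P \<and> h \<in> P \<and> h \<noteq> 0}"
  have E: "g / h \<in> E" if "g \<in> P" "h \<in> P" "h \<noteq> 0" for g h
    using that unfolding E_def by blast
  have "subfield E ambient"
  proof (rule subfieldI_ambient)
    show "1 \<in> E" using E[OF one one] by simp
    fix x assume "x \<in> E"
    then obtain g h where x: "x = g / h" "g \<in> P" "h \<in> P" "h \<noteq> 0"
      unfolding E_def by blast
    show "inverse x \<in> E" if "x \<noteq> 0"
      using E[of h g] that x by auto
    fix y assume "y \<in> E"
    then obtain g' h' where y: "y = g' / h'" "g' \<in> P" "h' \<in> P" "h' \<noteq> 0"
      unfolding E_def by blast
    have "x - y = (g * h' - g' * h) / (h * h')" "x * y = (g * g') / (h * h')"
      unfolding x(1) y(1) by (simp_all add: diff_frac_eq x(4) y(4))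
    then show "x - y \<in> E" "x * y \<in> E"
      using x y by (auto intro!: E mult diff)
  qed
  moreover have "Q \<union> f ` (I - {v}) \<union> {f v ^ d} \<subseteq> P"
  proof (intro Un_least subsetI)
    show "c \<in> P" if "c \<in> Q" for c
      using graded_monomial[of "{#}" c v d 0] that by (simp add: P_def)
    show "c \<in> P" if c: "c \<in> f ` (I - {v})" for c
    proof -
      obtain i where i: "c = f i" "i \<in> I" "i \<noteq> v" using c by blast
      then show ?thesis
        using graded_monomial[of "{#i#}" 1 v d 0] sf_1[OF Q] by (simp add: P_def)
    qed
    show "c \<in> P" if "c \<in> {f v ^ d}" for c
      using graded_monomial[of "replicate_mset d v" 1 v d 0] sf_1[OF Q] that v
      by (auto simp: P_def in_replicate_mset)
  qed
  moreover have "P \<subseteq> E" using E[OF _ one] by auto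
  ultimately have "f v ^ e \<in> E"
    using gen_least[of E] \<open>f v ^ e \<in> gen _\<close> by blast
  then obtain g h where gh: "f v ^ e = g / h" "g \<in> P" "h \<in> P" "h \<noteq> 0"
    unfolding E_def by blast
  have "f v ^ e \<in> graded v d e"
    using graded_monomial[of "replicate_mset e v" 1 v d e] sf_1[OF Q] e v by auto
  then have "f v ^ e * h \<in> graded v d e"
    using graded_mult[of "f v ^ e" v d e h 0] gh(3) e by (simp add: P_def)
  moreover have "f v ^ e * h = g" using gh by simp
  ultimately have "g = 0"
    using graded_disjoint[of g v d 0 e] gh(2) e by (simp add: P_def)
  then show False using gh indet_neq_0[OF v] by simp
qed

text \<open>These are the perfect closure of \<open>Q(S)\<close>, and \<open>E(v^p)\<close> for the perfect closure \<open>E\<close> of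
  \<open>Q(I - {v})\<close>. An element \<open>x\<close> lies in \<open>E(v^(p^(1 - n)))\<close> if and only if \<open>x^(p^n)\<close> lies in \<open>E(v^p)\<close>:
  so this single field measures how deep a root of \<open>v\<close> is needed to express \<open>x\<close>.\<close>

definition perf :: "'i set \<Rightarrow> 'a set" where
  "perf S = {x. \<exists>N. x ^ p ^ N \<in> gen (Q \<union> f ` S)}"

definition perf_without :: "'i \<Rightarrow> 'a set" where
  "perf_without v = {x. \<exists>N. x ^ p ^ N \<in> gen (Q \<union> f ` (I - {v}) \<union> {f v ^ p ^ Suc N})}"

lemma subfield_perf: "subfield (perf S) ambient"
proof -
  have "x ^ p ^ Suc N \<in> gen (Q \<union> f ` S)" if "x ^ p ^ N \<in> gen (Q \<union> f ` S)" for x N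
    unfolding pow_Suc(2) by (intro gen_closed that)
  then have "subfield (\<Union>N. {x. x ^ p ^ N \<in> gen (Q \<union> f ` S)}) ambient"
    by (intro sf_UN_chain sf_root gen_subfield) blast
  then show ?thesis by (simp add: perf_def Collect_ex_eq)
qed

lemma subfield_perf_without: "subfield (perf_without v) ambient"
proof -
  let ?G = "\<lambda>N. gen (Q \<union> f ` (I - {v}) \<union> {f v ^ p ^ Suc N})"
  have "x ^ p ^ Suc N \<in> ?G (Suc N)" if "x ^ p ^ N \<in> ?G N" for x N
  proof -
    have "s ^ p ^ 1 \<in> ?G (Suc N)" if s: "s \<in> Q \<union> f ` (I - {v}) \<union> {f v ^ p ^ Suc N}" for s
    proof (cases "s \<in> Q \<union> f ` (I - {v})")
      case True
      then show ?thesis by (intro gen_closed generate_field.incl) simp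
    next
      case False
      then have "s ^ p ^ 1 = f v ^ p ^ Suc (Suc N)" using s pow_Suc(2)[of "f v" "Suc N"] by auto
      then show ?thesis by (simp add: generate_field.incl)
    qed
    from gen_root[OF gen_subfield this that] show ?thesis
      unfolding pow_Suc(2)[of x N] by simp
  qed
  then have "subfield (\<Union>N. {x. x ^ p ^ N \<in> ?G N}) ambient"
    by (intro sf_UN_chain sf_root gen_subfield) blast
  then show ?thesis by (simp add: perf_without_def Collect_ex_eq)
qed

lemma perf_mono: "S \<subseteq> S' \<Longrightarrow> perf S \<subseteq> perf S'"
  unfolding perf_def using gen_mono[of "Q \<union> f ` S" "Q \<union> f ` S'"] by blast

lemma perf_base: "Q \<subseteq> perf S" and perf_indet: "v \<in> S \<Longrightarrow> f v \<in> perf S"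
proof -
  have "x \<in> perf S" if "x \<in> Q \<union> f ` S" for x
    unfolding perf_def using that by (intro CollectI exI[of _ 0]) (simp add: generate_field.incl)
  then show "Q \<subseteq> perf S" "v \<in> S \<Longrightarrow> f v \<in> perf S" by auto
qed

lemma perf_root: "x ^ p ^ n \<in> perf S \<longleftrightarrow> x \<in> perf S"
proof
  assume "x ^ p ^ n \<in> perf S"
  then show "x \<in> perf S" unfolding perf_def by (auto simp flip: pow_add)
qed (rule sf_power[OF subfield_perf])

lemma perf_subset: "v \<notin> S \<Longrightarrow> S \<subseteq> I \<Longrightarrow> perf S \<subseteq> perf_without v"
proof -
  assume "v \<notin> S" "S \<subseteq> I"
  then have "gen (Q \<union> f ` S) \<subseteq> gen (Q \<union> f ` (I - {v}) \<union> {f v ^ p ^ Suc N})" for N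
    by (intro gen_mono) auto
  then show ?thesis unfolding perf_def perf_without_def by blast
qed

lemma perf_without_indet: "w \<in> I \<Longrightarrow> w \<noteq> v \<Longrightarrow> f w \<in> perf_without v"
  using perf_subset[of v "{w}"] perf_indet[of w "{w}"] by auto

lemma perf_without_pow: "f v ^ p \<in> perf_without v"
  unfolding perf_without_def by (intro CollectI exI[of _ 0]) (simp add: generate_field.incl)

lemma perf_without_notin: "v \<in> I \<Longrightarrow> f v \<notin> perf_without v"
  unfolding perf_without_def
  using indet_power_notin[of v "p ^ N" "p ^ Suc N" for N] p_ge_2 by auto

end

section \<open>The tower\<close>

text \<open>The elements \<open>rho i\<close> are the \<open>p^i\<close>-th roots of \<open>X0\<close>, with \<open>rho 0 = X0\<close>. The dummy \<open>T 0 j = 0\<close>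
  makes the recursion uniform in the column.\<close>

locale tower_construction =
  independent_family p ty Q indets "indet_value X0 Z Y" for p and ty :: "'a::field itself"
    and Q :: "'a set" and X0 :: 'a and Z Y :: "nat \<Rightarrow> nat \<Rightarrow> 'a" +
  fixes rho :: "nat \<Rightarrow> 'a" and T :: "nat \<Rightarrow> nat \<Rightarrow> 'a"
  assumes rho: "rho i ^ p ^ i = X0"
    and row1: "1 \<le> i \<Longrightarrow> gen (Q \<union> {T i 1}) = gen (Q \<union> {rho i})"
    and T_pow: "1 \<le> i \<Longrightarrow> 2 \<le> j \<Longrightarrow>
      T i j ^ p = Z i j * T (2 * i) (j - 1) ^ p + T (i - 1) j + Y i j"
    and T_0: "2 \<le> j \<Longrightarrow> T 0 j = 0"
begin

abbreviation val :: "indet \<Rightarrow> 'a" where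
  "val \<equiv> indet_value X0 Z Y"

definition K :: "nat \<Rightarrow> 'a set" where
  "K n = gen (Q \<union> val ` indets \<union> {T i j |i j. 1 \<le> i \<and> 1 \<le> j \<and> j \<le> n})"

lemma subfield_K: "subfield (K n) ambient"
  unfolding K_def by (rule gen_subfield)

lemma K_mono: "m \<le> n \<Longrightarrow> K m \<subseteq> K n"
  unfolding K_def by (rule gen_mono) (blast intro: le_trans)

lemma K_base: "Q \<subseteq> K n" "v \<in> indets \<Longrightarrow> val v \<in> K n"
  unfolding K_def by (auto intro: generate_field.incl)

lemma T_in_K: "1 \<le> i \<Longrightarrow> 1 \<le> j \<Longrightarrow> j \<le> n \<Longrightarrow> T i j \<in> K n"
  unfolding K_def by (rule generate_field.incl) blast

lemma indets_mem: "VX \<in> indets" "1 \<le> i \<Longrightarrow> 2 \<le> j \<Longrightarrow> VZ i j \<in> indets"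
  "1 \<le> i \<Longrightarrow> 2 \<le> j \<Longrightarrow> VY i j \<in> indets"
  by (auto simp: indets_def)

lemma ZY_in:
  assumes "K 0 \<subseteq> F" "1 \<le> i" "2 \<le> j"
  shows "Z i j \<in> F" "Y i j \<in> F"
  using K_base(2)[of "VZ i j" 0] K_base(2)[of "VY i j" 0] assms by (auto simp: indets_mem)

lemma rho_pow: "rho (Suc i) ^ p = rho i"
  by (rule frob_inj[of _ i]) (metis pow_Suc(1) rho)

lemma row1_pow: "1 \<le> i \<Longrightarrow> T i 1 ^ p \<in> gen (Q \<union> {rho (i - 1)})"
proof -
  assume i: "1 \<le> i"
  then have "T i 1 \<in> gen (Q \<union> {rho i})"
    using row1[OF i] gen_incl[of "Q \<union> {T i 1}"] by blast
  moreover have "s ^ p ^ 1 \<in> gen (Q \<union> {rho (i - 1)})" if "s \<in> Q \<union> {rho i}" for s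
    using that rho_pow[of "i - 1"] i gen_incl[of "Q \<union> {rho (i - 1)}"]
    by (cases "s \<in> Q") (auto intro: gen_closed)
  ultimately show ?thesis
    using gen_root[OF gen_subfield, of "Q \<union> {rho i}" 1 "Q \<union> {rho (i - 1)}"] by simp
qed

lemma T_pow_in:
  assumes F: "subfield F ambient" "K 0 \<subseteq> F" and i: "1 \<le> i" and j: "1 \<le> j"
    and below: "2 \<le> j \<Longrightarrow> T (2 * i) (j - 1) \<in> F" and prev: "2 \<le> i \<Longrightarrow> T (i - 1) j \<in> F"
  shows "T i j ^ p \<in> F"
proof (cases "j = 1")
  case True
  have "gen (Q \<union> {rho (i - 1)}) \<subseteq> F"
  proof (cases "i = 1")
    case True
    have "rho 0 = X0" using rho[of 0] by simp
    then show ?thesis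
      using True F K_base(1)[of 0] K_base(2)[OF indets_mem(1), of 0] by (intro gen_least) auto
  next
    case False
    then have "gen (Q \<union> {rho (i - 1)}) = gen (Q \<union> {T (i - 1) 1})" using i row1 by simp
    also have "\<dots> \<subseteq> F"
      using F K_base(1)[of 0] prev False i True by (intro gen_least) auto
    finally show ?thesis .
  qed
  then show ?thesis using row1_pow[OF i] True by blast
next
  case False
  then have j2: "2 \<le> j" using j by simp
  have "T (i - 1) j \<in> F"
    using prev T_0[OF j2] sf_0[OF F(1)] i by (cases "i = 1") auto
  then show ?thesis
    unfolding T_pow[OF i j2]
    by (intro sf_add sf_mult sf_power F below j2 ZY_in[OF F(2) i j2])
qed

lemma T_pred_in:
  assumes F: "subfield F ambient" "K 0 \<subseteq> F" and i: "1 \<le> i" and j: "1 \<le> j"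
    and below: "2 \<le> j \<Longrightarrow> T (2 * Suc i) (j - 1) \<in> F" and T: "T (Suc i) j \<in> F"
  shows "T i j \<in> F"
proof (cases "j = 1")
  case True
  have "rho (Suc i) \<in> gen (Q \<union> {T (Suc i) 1})"
    using row1[of "Suc i"] gen_incl[of "Q \<union> {rho (Suc i)}"] by auto
  moreover have "gen (Q \<union> {T (Suc i) 1}) \<subseteq> F"
    using F K_base(1)[of 0] T True by (intro gen_least) auto
  ultimately have "rho i \<in> F"
    using rho_pow[of i] sf_power[OF F(1), of "rho (Suc i)" p] by auto
  then have "gen (Q \<union> {rho i}) \<subseteq> F"
    using F K_base(1)[of 0] by (intro gen_least) auto
  then show ?thesis
    using row1[OF i] gen_incl[of "Q \<union> {T i 1}"] True by auto
next
  case False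
  then have j2: "2 \<le> j" using j by simp
  have "T i j = T (Suc i) j ^ p - Z (Suc i) j * T (2 * Suc i) (j - 1) ^ p - Y (Suc i) j"
    using T_pow[of "Suc i" j] j2 by simp
  also have "\<dots> \<in> F"
    by (intro sf_diff sf_mult sf_power F below j2 T ZY_in[OF F(2) _ j2]) simp_all
  finally show ?thesis .
qed

text \<open>An upper bound for the indeterminates that occur when the recursion for \<open>T i j\<close> is unfolded:
  passing from \<open>(i, j)\<close> to \<open>(2 * i, j - 1)\<close> preserves \<open>i * 2^j\<close>, and passing to \<open>(i - 1, j)\<close> lowers
  it.\<close>

definition involved :: "nat \<Rightarrow> nat \<Rightarrow> indet set" where
  "involved i j = insert VX ({VZ a b |a b. 1 \<le> a \<and> 2 \<le> b \<and> b \<le> j \<and> a * 2 ^ b \<le> i * 2 ^ j} \<union>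
     {VY a b |a b. 1 \<le> a \<and> 2 \<le> b \<and> b \<le> j \<and> a * 2 ^ b \<le> i * 2 ^ j})"

lemma involved_indets: "involved i j \<subseteq> indets"
  by (auto simp: involved_def indets_def)

lemma T_in_perf:
  assumes "1 \<le> j" "1 \<le> i"
  shows "T i j \<in> perf (involved i j)"
  using assms
proof (induction j arbitrary: i rule: nat_induct_at_least)
  case base
  have "rho i ^ p ^ i \<in> perf (involved i 1)"
    using perf_indet[of VX] by (simp add: rho involved_def)
  then have "gen (Q \<union> {rho i}) \<subseteq> perf (involved i 1)"
    using perf_base by (intro gen_least subfield_perf) (auto simp: perf_root)
  then show ?case
    using row1[OF base] gen_incl[of "Q \<union> {T i 1}"] by auto
next
  case (Suc j)
  show ?case
    using Suc.prems
  proof (induction i rule: less_induct)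
    case (less i)
    let ?P = "perf (involved i (Suc j))"
    have j: "2 \<le> Suc j" using Suc.hyps by simp
    have "involved (2 * i) j \<subseteq> involved i (Suc j)"
      by (auto simp: involved_def)
    then have below: "T (2 * i) j \<in> ?P"
      by (rule subsetD[OF perf_mono Suc.IH]) (use less.prems in simp)
    have prev: "T (i - 1) (Suc j) \<in> ?P"
    proof (cases "i = 1")
      case True
      then show ?thesis using T_0[OF j] sf_0[OF subfield_perf] by simp
    next
      case False
      have "x \<le> i * 2 ^ Suc j" if "x \<le> (i - 1) * 2 ^ Suc j" for x
        using that by (rule order_trans) (intro mult_right_mono, auto)
      then have "involved (i - 1) (Suc j) \<subseteq> involved i (Suc j)"
        unfolding involved_def by blast
      then show ?thesis
        by (rule subsetD[OF perf_mono less.IH]) (use less.prems False in simp_all)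
    qed
    have "VZ i (Suc j) \<in> involved i (Suc j)" "VY i (Suc j) \<in> involved i (Suc j)"
      using less.prems j by (auto simp: involved_def)
    then have "Z i (Suc j) \<in> ?P" "Y i (Suc j) \<in> ?P"
      by (metis perf_indet indet_value.simps(2), metis perf_indet indet_value.simps(3))
    then have "T i (Suc j) ^ p \<in> ?P"
      unfolding T_pow[OF less.prems j]
      using below prev by (auto intro!: sf_add[OF subfield_perf] sf_mult[OF subfield_perf]
        sf_power[OF subfield_perf])
    then show ?case
      using perf_root[of "T i (Suc j)" 1] by simp
  qed
qed

text \<open>For \<open>j > n\<close> this is the exponent of \<open>T i j\<close> over \<open>K n\<close>.\<close>

definition weight :: "nat \<Rightarrow> nat \<Rightarrow> nat \<Rightarrow> nat" where
  "weight n i j = 2 ^ (j - Suc n) * i"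

lemma weight_Suc: "n < j \<Longrightarrow> weight n i (Suc j) = weight n (2 * i) j"
  using Suc_diff_Suc[of n j] by (simp add: weight_def flip: power_Suc2)

lemma weight_first: "weight n i (Suc n) = i"
  by (simp add: weight_def)

lemma weight_ge_1: "1 \<le> i \<Longrightarrow> 1 \<le> weight n i j"
  by (simp add: weight_def)

lemma weight_pred: "Suc n < j \<Longrightarrow> 1 \<le> i \<Longrightarrow> weight n (i - 1) j + 2 \<le> weight n i j"
proof -
  assume "Suc n < j" "1 \<le> i"
  then obtain l i' where "j - Suc n = Suc l" "i = Suc i'"
    by (metis Suc_diff_Suc Suc_le_D One_nat_def)
  then show ?thesis by (simp add: weight_def)
qed

text \<open>An indeterminate whose \<open>p^i\<close>-th root enters with \<open>T i (n + 1)\<close>.\<close>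

definition marker :: "nat \<Rightarrow> indet" where
  "marker n = (if n = 0 then VX else VY 1 (Suc n))"

definition D :: "nat \<Rightarrow> 'a set" where
  "D n = perf_without (marker n)"

lemma marker_indets: "marker n \<in> indets"
  by (auto simp: marker_def indets_def)

lemma subfield_D: "subfield (D n) ambient"
  unfolding D_def by (rule subfield_perf_without)

lemma marker_D: "val (marker n) ^ p \<in> D n" "val (marker n) \<notin> D n"
  unfolding D_def by (rule perf_without_pow) (rule perf_without_notin[OF marker_indets])

lemma D_indet: "v \<in> indets \<Longrightarrow> v \<noteq> marker n \<Longrightarrow> val v \<in> D n"
  unfolding D_def by (rule perf_without_indet)

lemma D_ZY:
  assumes "1 \<le> i" "2 \<le> j"
  shows "Z i j \<in> D n" "i \<noteq> 1 \<or> j \<noteq> Suc n \<Longrightarrow> Y i j \<in> D n"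
  using D_indet[of "VZ i j" n] D_indet[of "VY i j" n] assms
  by (auto simp: indets_mem marker_def split: if_splits)

lemma D_base: "Q \<subseteq> D n"
  using perf_base[of "{}"] perf_subset[of "marker n" "{}"] by (simp add: D_def)

lemma D_T: "1 \<le> i \<Longrightarrow> 1 \<le> j \<Longrightarrow> j \<le> n \<Longrightarrow> T i j \<in> D n"
proof -
  assume ij: "1 \<le> i" "1 \<le> j" "j \<le> n"
  then have "marker n \<notin> involved i j"
    by (auto simp: marker_def involved_def)
  then have "perf (involved i j) \<subseteq> D n"
    unfolding D_def using involved_indets by (rule perf_subset)
  then show ?thesis using T_in_perf ij by blast
qed

lemma D_power_mono: "x ^ p ^ a \<in> D n \<Longrightarrow> a \<le> b \<Longrightarrow> x ^ p ^ b \<in> D n"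
  using pow_add[of x a "b - a"] sf_power[OF subfield_D, of "x ^ p ^ a" n "p ^ (b - a)"] by simp

lemma D_add_iff: "x \<in> D n \<Longrightarrow> x + y \<in> D n \<longleftrightarrow> y \<in> D n"
  using sf_add[OF subfield_D, of x n y] sf_diff[OF subfield_D, of "x + y" n x] by auto

lemma D_mult_iff: "x \<in> D n \<Longrightarrow> x \<noteq> 0 \<Longrightarrow> x * y \<in> D n \<longleftrightarrow> y \<in> D n"
  using sf_mult[OF subfield_D, of x n y] sf_divide[OF subfield_D, of "x * y" n x] by auto

lemma depth_first_row:
  assumes "1 \<le> i"
  shows "T i (Suc n) ^ p ^ Suc i \<in> D n \<and> T i (Suc n) ^ p ^ i \<notin> D n"
proof (cases "n = 0")
  case True
  then have V: "val (marker n) = X0" by (simp add: marker_def)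
  have "T i 1 ^ p ^ Suc i \<in> D n"
  proof (rule gen_root[OF subfield_D])
    show "T i 1 \<in> gen (Q \<union> {rho i})"
      using row1[OF assms] gen_incl[of "Q \<union> {T i 1}"] by auto
    show "s ^ p ^ Suc i \<in> D n" if "s \<in> Q \<union> {rho i}" for s
    proof (cases "s \<in> Q")
      case True
      then show ?thesis using D_base sf_power[OF subfield_D] by blast
    next
      case False
      then have "s ^ p ^ Suc i = X0 ^ p" using that pow_Suc(2)[of "rho i" i] by (simp add: rho)
      then show ?thesis using marker_D(1)[of n] by (simp add: V)
    qed
  qed
  moreover have "T i 1 ^ p ^ i \<notin> D n"
  proof
    assume T: "T i 1 ^ p ^ i \<in> D n"
    have "rho i ^ p ^ i \<in> D n"
    proof (rule gen_root[OF subfield_D])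
      show "rho i \<in> gen (Q \<union> {T i 1})"
        using row1[OF assms] gen_incl[of "Q \<union> {rho i}"] by auto
      show "s ^ p ^ i \<in> D n" if "s \<in> Q \<union> {T i 1}" for s
        using that T D_base[of n] sf_power[OF subfield_D] by blast
    qed
    then show False using marker_D(2)[of n] by (simp add: rho V)
  qed
  ultimately show ?thesis using True by simp
next
  case False
  then have V: "val (marker n) = Y 1 (Suc n)" by (simp add: marker_def)
  have n: "2 \<le> Suc n" using False by simp
  define d where "d = (\<lambda>i. Z i (Suc n) * T (2 * i) n ^ p)"
  have d: "d i \<in> D n" if "1 \<le> i" for i
    unfolding d_def using that n
    by (intro sf_mult[OF subfield_D] sf_power[OF subfield_D] D_T D_ZY) auto
  show ?thesis
    using assms
  proof (induction i rule: nat_induct_at_least)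
    case base
    have eq: "T 1 (Suc n) ^ p = d 1 + Y 1 (Suc n)"
      using T_pow[of 1 "Suc n"] T_0[OF n] n by (simp add: d_def)
    have "T 1 (Suc n) ^ p ^ Suc 1 = d 1 ^ p + Y 1 (Suc n) ^ p"
      unfolding pow_Suc(1) eq by (simp add: frob_add1)
    moreover have "d 1 ^ p \<in> D n" by (intro sf_power[OF subfield_D] d) simp
    ultimately show ?case
      using D_add_iff[of "d 1 ^ p" n "Y 1 (Suc n) ^ p"] D_add_iff[OF d, of 1 "Y 1 (Suc n)"]
        marker_D[of n] unfolding V eq[symmetric] by simp
  next
    case (Suc i)
    define e where "e = d (Suc i) + Y (Suc i) (Suc n)"
    have e: "e \<in> D n"
      unfolding e_def using n Suc.hyps by (intro sf_add[OF subfield_D] d D_ZY) auto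
    have eq: "T (Suc i) (Suc n) ^ p = e + T i (Suc n)"
      using T_pow[of "Suc i" "Suc n"] n by (simp add: e_def d_def)
    have "T (Suc i) (Suc n) ^ p ^ Suc k \<in> D n \<longleftrightarrow> T i (Suc n) ^ p ^ k \<in> D n" for k
      unfolding pow_Suc(1)[of _ k] eq frob_add
      by (rule D_add_iff) (rule sf_power[OF subfield_D e])
    then show ?case using Suc.IH by blast
  qed
qed

text \<open>The root of the marker in \<open>T i j\<close> comes from \<open>T (2 * i) (j - 1)\<close>, which has the same weight:
  beyond the first row, the extra \<open>p\<close>-th root of \<open>T (i - 1) j\<close> does not make up for its smaller
  weight.\<close>

lemma depth:
  assumes "Suc n \<le> j" "1 \<le> i"
  shows "T i j ^ p ^ Suc (weight n i j) \<in> D n \<and> T i j ^ p ^ weight n i j \<notin> D n"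
  using assms
proof (induction j arbitrary: i rule: nat_induct_at_least)
  case base
  then show ?case using depth_first_row[of i n] by (simp add: weight_first)
next
  case (Suc j)
  have j: "2 \<le> Suc j" using Suc.hyps by simp
  show ?case
    using Suc.prems
  proof (induction i rule: less_induct)
    case (less i)
    define w where "w = weight n i (Suc j)"
    have w: "weight n (2 * i) j = w" "1 \<le> w"
      using weight_Suc[of n j i] Suc.hyps weight_ge_1[OF less.prems, of n "Suc j"]
      by (simp_all add: w_def)
    have below: "T (2 * i) j ^ p ^ Suc w \<in> D n" "T (2 * i) j ^ p ^ w \<notin> D n"
      using Suc.IH[of "2 * i"] less.prems w by auto
    have ZY: "Z i (Suc j) \<in> D n" "Y i (Suc j) \<in> D n"
      using D_ZY[OF less.prems j, of n] Suc.hyps by auto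
    have Z0: "Z i (Suc j) \<noteq> 0"
      using indet_neq_0[of "VZ i (Suc j)"] less.prems j by (simp add: indets_mem)
    have prev: "T (i - 1) (Suc j) ^ p ^ k \<in> D n" if "w - 1 \<le> k" for k
    proof (cases "i = 1")
      case True
      then show ?thesis using T_0[OF j] sf_0[OF subfield_D] p_pos by (simp add: power_0_left)
    next
      case False
      then have "Suc (weight n (i - 1) (Suc j)) \<le> k"
        using weight_pred[of n "Suc j" i] less.prems Suc.hyps that by (simp add: w_def)
      moreover have "T (i - 1) (Suc j) ^ p ^ Suc (weight n (i - 1) (Suc j)) \<in> D n"
        using less.IH[of "i - 1"] less.prems False by simp
      ultimately show ?thesis using D_power_mono by blast
    qed
    have key: "T i (Suc j) ^ p ^ Suc k \<in> D n \<longleftrightarrow> T (2 * i) j ^ p ^ Suc k \<in> D n"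
      if "w - 1 \<le> k" for k
    proof -
      have "T i (Suc j) ^ p ^ Suc k = (Y i (Suc j) ^ p ^ k + T (i - 1) (Suc j) ^ p ^ k)
          + Z i (Suc j) ^ p ^ k * T (2 * i) j ^ p ^ Suc k"
        unfolding pow_Suc(1) T_pow[OF less.prems j] frob_add power_mult_distrib
        by (simp add: algebra_simps)
      moreover have "Y i (Suc j) ^ p ^ k + T (i - 1) (Suc j) ^ p ^ k \<in> D n"
        by (rule sf_add[OF subfield_D sf_power[OF subfield_D ZY(2)] prev[OF that]])
      moreover have "Z i (Suc j) ^ p ^ k \<in> D n" "Z i (Suc j) ^ p ^ k \<noteq> 0"
        using ZY Z0 by (auto intro: sf_power[OF subfield_D])
      ultimately show ?thesis by (metis D_add_iff D_mult_iff)
    qed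
    show ?case
      using key[of w] key[of "w - 1"] below w(2) by (simp add: w_def[symmetric])
  qed
qed

text \<open>The generators are ordered by weight and then by row, because then the \<open>p\<close>-th power of each
  one lies in the field generated by its predecessors.\<close>

definition F :: "nat \<Rightarrow> nat \<Rightarrow> nat \<Rightarrow> 'a set" where
  "F n w r = gen (K n \<union>
     {T i j |i j. 1 \<le> i \<and> n < j \<and> (weight n i j < w \<or> weight n i j = w \<and> j \<le> r)})"

definition M :: "nat \<Rightarrow> nat \<Rightarrow> 'a set" where
  "M n m = gen (K n \<union> {T i j |i j. 1 \<le> i \<and> n < j \<and> weight n i j \<le> m})"

lemma subfield_F: "subfield (F n w r) ambient" and subfield_M: "subfield (M n m) ambient"
  unfolding F_def M_def by (rule gen_subfield)+

lemma K_le_F: "K n \<subseteq> F n w r" and K_le_M: "K n \<subseteq> M n m"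
  unfolding F_def M_def using gen_incl by blast+

lemma T_in_F:
  "1 \<le> i \<Longrightarrow> n < j \<Longrightarrow> weight n i j < w \<or> weight n i j = w \<and> j \<le> r \<Longrightarrow> T i j \<in> F n w r"
  unfolding F_def by (rule generate_field.incl) blast

lemma T_in_M: "1 \<le> i \<Longrightarrow> n < j \<Longrightarrow> weight n i j \<le> m \<Longrightarrow> T i j \<in> M n m"
  unfolding M_def by (rule generate_field.incl) blast

lemma M_mono: "m \<le> m' \<Longrightarrow> M n m \<subseteq> M n m'"
  unfolding M_def by (rule gen_mono) (blast intro: le_trans)

lemma F_start: "F n (Suc m) n = M n m"
proof -
  have "(n < j \<and> (weight n i j < Suc m \<or> weight n i j = Suc m \<and> j \<le> n)) =
    (n < j \<and> weight n i j \<le> m)" for i j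
    by auto
  then show ?thesis unfolding F_def M_def by simp
qed

lemma F_end: "M n w \<subseteq> F n w (n + w)"
  unfolding M_def
proof (rule gen_least[OF subfield_F], intro Un_least subsetI)
  fix x assume "x \<in> {T i j |i j. 1 \<le> i \<and> n < j \<and> weight n i j \<le> w}"
  then obtain i j where x: "x = T i j" "1 \<le> i" "n < j" "weight n i j \<le> w" by blast
  have "j - Suc n < 2 ^ (j - Suc n)" by (rule less_exp)
  also have "\<dots> \<le> weight n i j" using x(2) by (simp add: weight_def)
  finally have "j \<le> n + w" using x(4) by simp
  then show "x \<in> F n w (n + w)" unfolding x(1) using x by (intro T_in_F) auto
qed (use K_le_F in blast)

lemma weight_less: "i < i' \<Longrightarrow> weight n i j < weight n i' j"
  by (simp add: weight_def)

lemma weight_scaled: "n < j \<Longrightarrow> weight n i j * 2 ^ Suc n = i * 2 ^ j"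
proof -
  assume "n < j"
  then have "(2::nat) ^ j = 2 ^ (j - Suc n) * 2 ^ Suc n"
    by (metis power_add le_add_diff_inverse2 Suc_leI)
  then show ?thesis by (simp add: weight_def)
qed

lemma K_depth: "x \<in> K n \<Longrightarrow> x ^ p \<in> D n"
proof -
  assume x: "x \<in> K n"
  have "s ^ p ^ 1 \<in> D n"
    if s: "s \<in> Q \<union> val ` indets \<union> {T i j |i j. 1 \<le> i \<and> 1 \<le> j \<and> j \<le> n}" for s
  proof (cases "s = val (marker n)")
    case True
    then show ?thesis using marker_D(1) by simp
  next
    case False
    consider "s \<in> Q" | v where "v \<in> indets" "s = val v" | i j where "1 \<le> i" "1 \<le> j" "j \<le> n" "s = T i j"
      using s by blast
    then have "s \<in> D n"
    proof cases
      case (2 v)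
      then show ?thesis using False D_indet[of v n] by auto
    qed (use D_base D_T in auto)
    then show ?thesis by (rule sf_power[OF subfield_D])
  qed
  from gen_root[OF subfield_D this x[unfolded K_def]] show ?thesis by simp
qed

lemma M_depth: "x \<in> M n m \<Longrightarrow> m < k \<Longrightarrow> x ^ p ^ k \<in> D n"
proof -
  assume x: "x \<in> M n m" and k: "m < k"
  have "s ^ p ^ k \<in> D n"
    if s: "s \<in> K n \<union> {T i j |i j. 1 \<le> i \<and> n < j \<and> weight n i j \<le> m}" for s
  proof (cases "s \<in> K n")
    case True
    then show ?thesis using K_depth[of s n] D_power_mono[of s 1 n k] k by simp
  next
    case False
    then obtain i j where "s = T i j" "1 \<le> i" "n < j" "weight n i j \<le> m" using s by blast
    then show ?thesis using depth[of n j i] D_power_mono[of s "Suc (weight n i j)" n k] k by auto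
  qed
  from gen_root[OF subfield_D this x[unfolded M_def]] show ?thesis .
qed

text \<open>Up to the factor \<open>2^(n + 1)\<close>, the weight of \<open>(i, j)\<close> is the quantity \<open>i * 2^j\<close> that bounds the
  indeterminates involved; so \<open>Z i j\<close> and \<open>Y i j\<close> are new when \<open>T i j\<close> is adjoined.\<close>

lemma earlier_free:
  assumes "n < j" "1 \<le> i'" "1 \<le> j'"
    and earlier: "n < j' \<Longrightarrow> weight n i' j' < weight n i j \<or> weight n i' j' = weight n i j \<and> j' < j"
    and v: "v \<in> {VZ i j, VY i j}"
  shows "T i' j' \<in> perf_without v"
proof -
  have "\<not> (j \<le> j' \<and> i * 2 ^ j \<le> i' * 2 ^ j')"
  proof
    assume A: "j \<le> j' \<and> i * 2 ^ j \<le> i' * 2 ^ j'"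
    then have "n < j'" using assms(1) by simp
    then have "weight n i' j' * 2 ^ Suc n < weight n i j * 2 ^ Suc n"
      using earlier A by (intro mult_strict_right_mono) auto
    then show False
      using A unfolding weight_scaled[OF assms(1)] weight_scaled[OF \<open>n < j'\<close>] by simp
  qed
  then have "v \<notin> involved i' j'" using v by (auto simp: involved_def)
  then show ?thesis
    using perf_subset[OF _ involved_indets] T_in_perf[OF assms(3,2)] by blast
qed

text \<open>Write \<open>x\<close> as a polynomial in the last generator \<open>T i (r + 1)\<close>; it is to be constant. In row
  \<open>n + 1\<close>, this generator needs a deeper root of the marker than \<open>x\<close> and the coefficients do. In the other rows, \<open>T i (r + 1) ^ p\<close> is \<open>Z c + b + Y\<close> for indeterminates
  \<open>Z\<close> and \<open>Y\<close> that do not occur in the earlier generators, and \<open>c = T (2 * i) r ^ p\<close> is too deep to lie in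
  \<open>M n m\<close>.\<close>

lemma root_step:
  assumes w: "Suc m < w" and r: "n \<le> r" and i: "1 \<le> i" and weight: "weight n i (Suc r) = w"
    and x: "x \<in> gen (F n w r \<union> {T i (Suc r)})" "x ^ p \<in> M n m"
  shows "x \<in> F n w r"
proof -
  have sF: "subfield (F n w r) ambient" by (rule subfield_F)
  have K0: "K 0 \<subseteq> F n w r" using K_mono[of 0 n] K_le_F by blast
  have below: "weight n (2 * i) r = w" if "n < r"
    using weight_Suc[OF that] weight by simp
  have TpF: "T i (Suc r) ^ p \<in> F n w r"
  proof (rule T_pow_in[OF sF K0 i])
    show "T (2 * i) (Suc r - 1) \<in> F n w r" if "2 \<le> Suc r"
    proof (cases "n < r")
      case True
      then show ?thesis using i below by (intro T_in_F) auto
    next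
      case False
      then show ?thesis using T_in_K[of "2 * i" r n] K_le_F i that by auto
    qed
    show "T (i - 1) (Suc r) \<in> F n w r" if "2 \<le> i"
      using weight_less[of "i - 1" i n "Suc r"] weight that r by (intro T_in_F) auto
  qed simp
  obtain f where f: "poly_over (F n w r) f" "degree f < p" "x = poly f (T i (Suc r))"
    using adjoin_root_poly[OF sF TpF x(1)] .
  show ?thesis
  proof (cases "r = n")
    case True
    define E where "E = {y. y ^ p ^ w \<in> D n}"
    have E: "subfield E ambient" unfolding E_def by (rule sf_root[OF subfield_D])
    have FE: "F n w r \<subseteq> E"
      using M_depth[of _ n "w - 1" w] F_start[of n "w - 1"] w True by (auto simp: E_def)
    have TE: "T i (Suc r) \<notin> E"
      using depth[of n "Suc n" i] weight i True by (simp add: E_def)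
    have "x ^ p ^ Suc (Suc m) \<in> D n"
      using M_depth[OF x(2), of "Suc m"] unfolding pow_Suc(1)[of x "Suc m"] by simp
    from D_power_mono[OF this, of w] have "x \<in> E" using w by (simp add: E_def)
    then show ?thesis
      using p_independent_const[OF E TE _ FE f(1,2)] TpF FE f(3) by auto
  next
    case False
    then have nr: "n < r" using r by simp
    then have j2: "2 \<le> Suc r" by simp
    define vZ vY where "vZ = VZ i (Suc r)" and "vY = VY i (Suc r)"
    \<comment> \<open>\<open>H\<close> contains \<open>Z^p\<close> and \<open>Y^p\<close> and all that is free of \<open>Z\<close> and \<open>Y\<close>, but \<open>Z\<close> is not in \<open>H\<close> and
      \<open>Y\<close> is not in \<open>H(Z)\<close>.\<close>
    define H where "H = perf_without vZ \<inter> perf_without vY"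
    have H: "subfield H ambient" unfolding H_def by (intro sf_Int subfield_perf_without)
    have ind: "vZ \<in> indets" "vY \<in> indets" "vZ \<noteq> vY"
      using indets_mem i j2 by (auto simp: vZ_def vY_def)
    have val: "val vZ = Z i (Suc r)" "val vY = Y i (Suc r)" by (simp_all add: vZ_def vY_def)
    have QH: "Q \<subseteq> H"
      using perf_base[of "{}"] perf_subset[of _ "{}"] by (simp add: H_def) blast
    have valH: "val v \<in> H" if "v \<in> indets" "v \<noteq> vZ" "v \<noteq> vY" for v
      unfolding H_def using that by (simp add: perf_without_indet)
    have ZH: "Z i (Suc r) ^ p \<in> H" "Z i (Suc r) \<notin> H" "Z i (Suc r) \<in> perf_without vY"
      using perf_without_pow[of vZ] perf_without_notin[OF ind(1)] perf_without_indet[OF ind(1,3)]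
      by (auto simp: H_def val intro: sf_power[OF subfield_perf_without])
    have YH: "Y i (Suc r) ^ p \<in> H" "Y i (Suc r) \<notin> perf_without vY"
      using perf_without_pow[of vY] perf_without_notin[OF ind(2)]
        perf_without_indet[OF ind(2) ind(3)[symmetric]]
      by (auto simp: H_def val intro: sf_power[OF subfield_perf_without])
    have TH: "T i' j' \<in> H" if "1 \<le> i'" "1 \<le> j'"
      "n < j' \<Longrightarrow> weight n i' j' < w \<or> weight n i' j' = w \<and> j' < Suc r" for i' j'
      using earlier_free[of n "Suc r" i' j' i] that weight r by (simp add: H_def vZ_def vY_def)
    have KH: "s \<in> H" if s: "s \<in> Q \<union> val ` indets \<union> {T i j |i j. 1 \<le> i \<and> 1 \<le> j \<and> j \<le> n}"
      "s \<noteq> Z i (Suc r)" "s \<noteq> Y i (Suc r)" for s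
    proof -
      consider "s \<in> Q" | v where "v \<in> indets" "s = val v"
        | i' j' where "1 \<le> i'" "1 \<le> j'" "j' \<le> n" "s = T i' j'"
        using s(1) by blast
      then show ?thesis
        using QH valH TH s(2,3) val by cases (blast, blast, simp)
    qed
    have pH: "y ^ p \<in> H" if y: "y \<in> F n w r" for y
    proof -
      have sF: "s ^ p ^ 1 \<in> H"
        if s: "s \<in> Q \<union> val ` indets \<union> {T i j |i j. 1 \<le> i \<and> 1 \<le> j \<and> j \<le> n}" for s
        using KH[OF s] ZH(1) YH(1) sf_power[OF H, of s p] by (cases "s = Z i (Suc r) \<or> s = Y i (Suc r)") auto
      have sK: "s ^ p ^ 1 \<in> H" if "s \<in> K n" for s
        using gen_root[OF H sF that[unfolded K_def]] .
      have "s ^ p ^ 1 \<in> H" if s: "s \<in> K n \<union> {T i j |i j. 1 \<le> i \<and> n < j \<and>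
          (weight n i j < w \<or> weight n i j = w \<and> j \<le> r)}" for s
      proof (cases "s \<in> K n")
        case False
        then obtain i' j' where "s = T i' j'" "1 \<le> i'" "n < j'"
          "weight n i' j' < w \<or> weight n i' j' = w \<and> j' \<le> r" using s by blast
        then have "s \<in> H" using TH[of i' j'] by auto
        then show ?thesis by (rule sf_power[OF H])
      qed (rule sK)
      from gen_root[OF H this y[unfolded F_def]] show ?thesis by simp
    qed
    define R where "R = M n m \<inter> H"
    have R: "subfield R ambient" unfolding R_def by (intro sf_Int subfield_M H)
    have KM: "s \<in> M n m" if "s \<in> Q \<union> val ` indets \<union> {T i j |i j. 1 \<le> i \<and> 1 \<le> j \<and> j \<le> n}" for s
      using subsetD[OF K_le_M, of s n m] generate_field.incl[OF that, of ambient] by (simp only: K_def)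
    have ZYM: "Z i (Suc r) \<in> M n m" "Y i (Suc r) \<in> M n m"
      using K_base(2)[OF ind(1), of n] K_base(2)[OF ind(2), of n] K_le_M[of n m] val by auto
    have MR: "M n m \<subseteq> gen (R \<union> {Z i (Suc r), Y i (Suc r)})"
      unfolding M_def
    proof (rule gen_least[OF gen_subfield], rule Un_least)
      show "{T i j |i j. 1 \<le> i \<and> n < j \<and> weight n i j \<le> m} \<subseteq> gen (R \<union> {Z i (Suc r), Y i (Suc r)})"
      proof
        fix s assume "s \<in> {T i j |i j. 1 \<le> i \<and> n < j \<and> weight n i j \<le> m}"
        then obtain i' j' where s: "s = T i' j'" "1 \<le> i'" "n < j'" "weight n i' j' \<le> m" by blast
        then have "s \<in> R" using TH[of i' j'] T_in_M[of i' n j' m] w by (simp add: R_def)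
        then show "s \<in> gen (R \<union> {Z i (Suc r), Y i (Suc r)})" by (simp add: generate_field.incl)
      qed
      show "K n \<subseteq> gen (R \<union> {Z i (Suc r), Y i (Suc r)})"
        unfolding K_def
      proof (rule gen_least[OF gen_subfield], rule subsetI)
        fix s assume s: "s \<in> Q \<union> val ` indets \<union> {T i j |i j. 1 \<le> i \<and> 1 \<le> j \<and> j \<le> n}"
        have "s \<in> R \<union> {Z i (Suc r), Y i (Suc r)}"
          using KH[OF s] KM[OF s] by (auto simp: R_def)
        then show "s \<in> gen (R \<union> {Z i (Suc r), Y i (Suc r)})" by (rule generate_field.incl)
      qed
    qed
    define c where "c = T (2 * i) r ^ p"
    define b where "b = T (i - 1) (Suc r)"
    have Tp: "T i (Suc r) ^ p = Z i (Suc r) * c + b + Y i (Suc r)"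
      unfolding T_pow[OF i j2] by (simp add: c_def b_def)
    have c: "c \<in> H"
      unfolding c_def using TH[of "2 * i" r] below[OF nr] i nr by (intro sf_power[OF H]) simp
    have b: "b \<in> H"
    proof (cases "i = 1")
      case True
      then show ?thesis using T_0[OF j2] sf_0[OF H] by (simp add: b_def)
    next
      case False
      then show ?thesis
        using TH[of "i - 1" "Suc r"] weight_less[of "i - 1" i n "Suc r"] weight i by (simp add: b_def)
    qed
    have "c \<notin> M n m"
    proof
      assume "c \<in> M n m"
      then have "T (2 * i) r ^ p ^ Suc (Suc m) \<in> D n"
        using M_depth[of c n m "Suc m"] unfolding pow_Suc(1)[of _ "Suc m"] c_def by simp
      from D_power_mono[OF this, of w] have "T (2 * i) r ^ p ^ w \<in> D n" using w by simp
      then show False using depth[of n r "2 * i"] below[OF nr] nr i by simp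
    qed
    then have cR: "c \<notin> R" by (simp add: R_def)
    define g where "g = map_poly (\<lambda>c. c ^ p) f"
    have cg: "coeff g l = coeff f l ^ p" for l
      unfolding g_def using p_pos by (subst coeff_map_poly) (simp_all add: power_0_left)
    have dg: "degree g = degree f"
      unfolding g_def by (rule degree_map_poly) simp
    have xg: "x ^ p = poly g (T i (Suc r) ^ p)"
      by (simp add: f(3) poly_altdef frob_sum1 power_mult_distrib cg dg
          power_mult[symmetric] mult.commute)
    have "degree g = 0"
    proof (rule two_variables[OF R H subfield_perf_without[of vY]])
      show "poly_over H g" using pH poly_overD[OF f(1)] by (simp add: poly_over_def cg)
      show "poly g (Z i (Suc r) * c + b + Y i (Suc r)) \<in> gen (R \<union> {Z i (Suc r), Y i (Suc r)})"
        using x(2) MR by (simp add: xg Tp[symmetric] subset_iff)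
      show "Z i (Suc r) ^ p \<in> R" "Y i (Suc r) ^ p \<in> R"
        using ZYM ZH(1) YH(1) by (auto simp: R_def intro: sf_power[OF subfield_M])
      show "R \<subseteq> H" "H \<subseteq> perf_without vY" by (auto simp: R_def H_def)
    qed (use ZH YH c cR b dg f(2) in auto)
    then have "degree f = 0" using dg by simp
    then obtain a where "f = [:a:]" by (rule degree_eq_zeroE)
    then show ?thesis using f(1,3) by (simp add: poly_over_pCons[OF sF])
  qed
qed

definition Kinf :: "'a set" where
  "Kinf = (\<Union>n. K n)"

lemma subfield_Kinf: "subfield Kinf ambient"
  unfolding Kinf_def by (intro sf_UN_chain subfield_K K_mono) simp

lemma Kinf_le_M: "Kinf \<subseteq> (\<Union>w. M n w)"
proof -
  have sub: "subfield (\<Union>w. M n w) ambient"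
    by (intro sf_UN_chain subfield_M M_mono) simp
  have "K N \<subseteq> (\<Union>w. M n w)" for N
    unfolding K_def[of N]
  proof (rule gen_least[OF sub], intro Un_least subsetI)
    fix x assume "x \<in> {T i j |i j. 1 \<le> i \<and> 1 \<le> j \<and> j \<le> N}"
    then obtain i j where x: "x = T i j" "1 \<le> i" "1 \<le> j" by blast
    show "x \<in> (\<Union>w. M n w)"
    proof (cases "n < j")
      case True
      then show ?thesis using T_in_M[of i n j "weight n i j"] x by blast
    next
      case False
      then show ?thesis using T_in_K[of i j n] K_le_M x by fastforce
    qed
  next
    fix x assume "x \<in> Q"
    then show "x \<in> (\<Union>w. M n w)" using K_base(1)[of n] K_le_M[of n 0] by blast
  next
    fix x assume "x \<in> val ` indets"
    then obtain v where "v \<in> indets" "x = val v" by blast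
    then show "x \<in> (\<Union>w. M n w)" using K_base(2)[of v n] K_le_M[of n 0] by blast
  qed
  then show ?thesis unfolding Kinf_def by blast
qed

text \<open>Generators of weight above \<open>m + 1\<close> are removed from \<open>x\<close> one at a time, the last one
  first.\<close>

lemma root_in_M_Suc:
  assumes "x \<in> Kinf" "x ^ p \<in> M n m"
  shows "x \<in> M n (Suc m)"
proof -
  have down: "x \<in> F n w n" if w: "Suc m < w" and "n \<le> r" "x \<in> F n w r" for w r
    using that(2,3)
  proof (induction r rule: nat_induct_at_least)
    case (Suc r)
    have "x \<in> F n w r"
    proof (cases "\<exists>i. 1 \<le> i \<and> weight n i (Suc r) = w")
      case True
      then obtain i where i: "1 \<le> i" "weight n i (Suc r) = w" by blast
      have uniq: "i' = i" if "weight n i' (Suc r) = w" for i'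
        using weight_less[of i i' n "Suc r"] weight_less[of i' i n "Suc r"] i(2) that
        by (cases i i' rule: linorder_cases) auto
      have "F n w (Suc r) \<subseteq> gen (F n w r \<union> {T i (Suc r)})"
        unfolding F_def[of n w "Suc r"]
      proof (rule gen_least[OF gen_subfield], intro Un_least subsetI)
        fix y assume "y \<in> {T i j |i j. 1 \<le> i \<and> n < j \<and>
          (weight n i j < w \<or> weight n i j = w \<and> j \<le> Suc r)}"
        then obtain i' j' where y: "y = T i' j'" "1 \<le> i'" "n < j'"
          "weight n i' j' < w \<or> weight n i' j' = w \<and> j' \<le> Suc r" by blast
        have "y \<in> F n w r \<union> {T i (Suc r)}"
        proof (cases "weight n i' j' = w \<and> j' = Suc r")
          case True
          have "i' = i" by (rule uniq) (use True in auto)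
          then show ?thesis using True y(1) by simp
        next
          case False
          then show ?thesis using T_in_F[of i' n j' w r] y by auto
        qed
        then show "y \<in> gen (F n w r \<union> {T i (Suc r)})" by (rule generate_field.incl)
      qed (use K_le_F[of n w r] gen_incl in blast)
      then show ?thesis
        using root_step[OF w Suc.hyps i _ assms(2)] Suc.prems by blast
    next
      case False
      have "F n w (Suc r) \<subseteq> F n w r"
        unfolding F_def
        by (rule gen_mono) (use False le_Suc_eq in blast)
      then show ?thesis using Suc.prems by blast
    qed
    then show ?case by (rule Suc.IH)
  qed
  have "x \<in> M n (Suc m)" if "x \<in> M n w" for w
    using that
  proof (induction w)
    case 0
    then show ?case using M_mono[of 0 "Suc m" n] by auto
  next
    case (Suc w)
    show ?case
    proof (cases "Suc m < Suc w")
      case True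
      then have "x \<in> M n w"
        using down[OF True, of "n + Suc w"] F_end[of n "Suc w"] Suc.prems F_start by auto
      then show ?thesis by (rule Suc.IH)
    next
      case False
      then show ?thesis using M_mono[of "Suc w" "Suc m" n] Suc.prems by auto
    qed
  qed
  then show ?thesis using Kinf_le_M assms(1) by blast
qed

theorem exponent_bound:
  assumes "x \<in> Kinf" "x ^ p ^ m \<in> K n"
  shows "x \<in> M n m"
  using assms
proof (induction m arbitrary: x)
  case 0
  then show ?case using K_le_M by auto
next
  case (Suc m)
  have "x ^ p \<in> Kinf" using Suc.prems(1) by (rule sf_power[OF subfield_Kinf])
  moreover have "(x ^ p) ^ p ^ m \<in> K n" using Suc.prems(2) by (simp only: pow_Suc(1))
  ultimately have "x ^ p \<in> M n m" by (rule Suc.IH)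
  then show ?case using root_in_M_Suc Suc.prems(1) by blast
qed

section \<open>Intermediate fields\<close>

text \<open>Each \<open>T i (n + 1)\<close> generates its predecessors in the row, so this is \<open>K n (T r (n + 1))\<close> for
  \<open>r > 0\<close>.\<close>

definition U :: "nat \<Rightarrow> nat \<Rightarrow> 'a set" where
  "U n r = gen (K n \<union> {T i (Suc n) |i. 1 \<le> i \<and> i \<le> r})"

lemma subfield_U: "subfield (U n r) ambient"
  unfolding U_def by (rule gen_subfield)

lemma K_le_U: "K n \<subseteq> U n r"
  unfolding U_def using gen_incl by blast

lemma T_in_U: "1 \<le> i \<Longrightarrow> i \<le> r \<Longrightarrow> T i (Suc n) \<in> U n r"
  unfolding U_def by (rule generate_field.incl) blast

lemma U_cases:
  assumes "s \<in> K n \<union> {T i (Suc n) |i. 1 \<le> i \<and> i \<le> r}"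
  obtains "s \<in> K n" | i where "1 \<le> i" "i \<le> r" "s = T i (Suc n)"
  using assms by blast

lemma U_0: "U n 0 = K n"
proof -
  have "{T i (Suc n) |i. 1 \<le> i \<and> i \<le> 0} = {}" by auto
  then show ?thesis
    unfolding U_def using gen_least[OF subfield_K, of "K n" n] gen_incl by fastforce
qed

lemma U_Suc: "U n (Suc r) \<subseteq> gen (U n r \<union> {T (Suc r) (Suc n)})"
  unfolding U_def[of n "Suc r"]
proof (rule gen_least[OF gen_subfield], rule subsetI)
  fix s assume "s \<in> K n \<union> {T i (Suc n) |i. 1 \<le> i \<and> i \<le> Suc r}"
  then have "s \<in> U n r \<union> {T (Suc r) (Suc n)}"
  proof (cases rule: U_cases)
    case 1
    then show ?thesis using K_le_U by blast
  next
    case (2 i)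
    then show ?thesis using T_in_U[of i r n] by (cases "i = Suc r") auto
  qed
  then show "s \<in> gen (U n r \<union> {T (Suc r) (Suc n)})" by (rule generate_field.incl)
qed

lemma first_row_pow: "T (Suc r) (Suc n) ^ p \<in> U n r"
proof (rule T_pow_in[OF subfield_U])
  show "K 0 \<subseteq> U n r" using K_mono[of 0 n] K_le_U by blast
  show "T (2 * Suc r) (Suc n - 1) \<in> U n r" if "2 \<le> Suc n"
    using T_in_K[of "2 * Suc r" n n] K_le_U[of n r] that by auto
  show "T (Suc r - 1) (Suc n) \<in> U n r" if "2 \<le> Suc r"
    using T_in_U[of r r n] that by simp
qed simp_all

lemma U_exponent: "x \<in> U n r \<Longrightarrow> x ^ p ^ r \<in> K n"
proof (induction r arbitrary: x)
  case 0
  then show ?case by (simp add: U_0)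
next
  case (Suc r)
  have "s ^ p ^ Suc r \<in> K n" if "s \<in> U n r \<union> {T (Suc r) (Suc n)}" for s
  proof (cases "s \<in> U n r")
    case True
    then show ?thesis unfolding pow_Suc(2) by (intro sf_power[OF subfield_K] Suc.IH)
  next
    case False
    then show ?thesis unfolding pow_Suc(1) using that first_row_pow Suc.IH by auto
  qed
  then show ?case using gen_root[OF subfield_K] U_Suc[of n r] Suc.prems by blast
qed

lemma first_row_power:
  "1 \<le> i \<Longrightarrow> i \<le> r + t \<Longrightarrow> T i (Suc n) ^ p ^ t \<in> U n r"
proof (induction t arbitrary: i)
  case 0
  then show ?case by (simp add: T_in_U)
next
  case (Suc t)
  have "T i (Suc n) ^ p \<in> U n (i - 1)"
    using first_row_pow[of "i - 1" n] Suc.prems by simp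
  moreover have "s ^ p ^ t \<in> U n r"
    if "s \<in> K n \<union> {T i' (Suc n) |i'. 1 \<le> i' \<and> i' \<le> i - 1}" for s
    using that
  proof (cases rule: U_cases)
    case 1
    then show ?thesis using K_le_U by (blast intro: sf_power[OF subfield_U])
  next
    case (2 i')
    then show ?thesis using Suc.IH[of i'] Suc.prems by simp
  qed
  ultimately show ?case
    unfolding pow_Suc(1) U_def[of n "i - 1"] by (rule gen_root[OF subfield_U, rotated])
qed

text \<open>Expand \<open>T i j ^ (p ^ t)\<close> by the recursion. Passing to \<open>(2 * i, j - 1)\<close> keeps weight and \<open>t\<close>.
  Passing to \<open>(i - 1, j)\<close> lowers \<open>t\<close> by one, but the weight by \<open>2^(j - n - 1)\<close>, which is at least 2
  beyond row \<open>n + 1\<close>; so if the weight is at most \<open>2 * t\<close>, it stays so, and \<open>t\<close> is not used up before row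
  \<open>n + 1\<close> or column \<open>0\<close> is reached.\<close>

lemma power_in_first_row:
  assumes "Suc n \<le> j" "1 \<le> i" "weight n i j \<le> r + t" "weight n i j \<le> 2 * t"
  shows "T i j ^ p ^ t \<in> U n r"
  using assms
proof (induction j arbitrary: i t rule: nat_induct_at_least)
  case base
  then show ?case using first_row_power[of i r t n] by (simp add: weight_first)
next
  case (Suc j)
  have j: "2 \<le> Suc j" using Suc.hyps by simp
  show ?case
    using Suc.prems
  proof (induction i arbitrary: t rule: less_induct)
    case (less i)
    then have "1 \<le> 2 * t" using weight_ge_1[of i n "Suc j"] by linarith
    then obtain k where t: "t = Suc k" by (cases t) auto
    have "T (2 * i) j ^ p ^ t \<in> U n r"
      using Suc.IH[of "2 * i" t] less.prems weight_Suc[of n j i] Suc.hyps by simp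
    moreover have "T (i - 1) (Suc j) ^ p ^ k \<in> U n r"
    proof (cases "i = 1")
      case True
      then show ?thesis using T_0[OF j] sf_0[OF subfield_U] p_pos by (simp add: power_0_left)
    next
      case False
      then show ?thesis
        using less.IH[of "i - 1" k] less.prems weight_pred[of n "Suc j" i] Suc.hyps by (simp add: t)
    qed
    moreover have "T i (Suc j) ^ p ^ t = Z i (Suc j) ^ p ^ k * T (2 * i) j ^ p ^ t
        + T (i - 1) (Suc j) ^ p ^ k + Y i (Suc j) ^ p ^ k"
      unfolding t pow_Suc(1) T_pow[OF less.prems(1) j] frob_add power_mult_distrib by simp
    moreover have "Z i (Suc j) \<in> U n r" "Y i (Suc j) \<in> U n r"
      using ZY_in[of "U n r" i "Suc j"] K_mono[of 0 n] K_le_U[of n r] less.prems j by auto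
    ultimately show ?case
      by (auto intro!: sf_add[OF subfield_U] sf_mult[OF subfield_U] intro: sf_power[OF subfield_U])
  qed
qed

lemma M_power:
  assumes "x \<in> M n e" "e \<le> r + t" "e \<le> 2 * t"
  shows "x ^ p ^ t \<in> U n r"
proof -
  have "s ^ p ^ t \<in> U n r"
    if s: "s \<in> K n \<union> {T i j |i j. 1 \<le> i \<and> n < j \<and> weight n i j \<le> e}" for s
  proof (cases "s \<in> K n")
    case True
    then show ?thesis using K_le_U by (blast intro: sf_power[OF subfield_U])
  next
    case False
    then obtain i j where "s = T i j" "1 \<le> i" "n < j" "weight n i j \<le> e" using s by blast
    then show ?thesis using power_in_first_row[of n j i r t] assms(2,3) by simp
  qed
  from gen_root[OF subfield_U this assms(1)[unfolded M_def]] show ?thesis .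
qed

lemma Kinf_exponent:
  assumes "x \<in> Kinf"
  shows "\<exists>e. x ^ p ^ e \<in> K n"
proof -
  obtain e where "x \<in> M n e" using assms Kinf_le_M by blast
  then have "x ^ p ^ e \<in> U n e" by (rule M_power) auto
  then have "x ^ p ^ (e + e) \<in> K n" unfolding pow_add by (rule U_exponent)
  then show ?thesis ..
qed

text \<open>If \<open>x\<close> in \<open>L\<close> has exponent \<open>e > 2 * r\<close> over \<open>K n\<close>, then \<open>x^(p^(e - r))\<close> has exponent \<open>r\<close>
  and lies in \<open>U n r\<close>, but not in \<open>U n (r - 1)\<close>, which only has elements of exponent below \<open>r\<close>.\<close>

lemma unbounded_absorbs:
  assumes L: "subfield L ambient" "K n \<subseteq> L" "L \<subseteq> Kinf"
    and unbounded: "\<And>s. \<exists>x\<in>L. x ^ p ^ s \<notin> K n"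
  shows "K (Suc n) \<subseteq> L"
proof -
  have U: "U n r \<subseteq> L" for r
  proof (induction r)
    case 0
    then show ?case using L(2) by (simp add: U_0)
  next
    case (Suc r)
    obtain x where x: "x \<in> L" "x ^ p ^ (2 * Suc r) \<notin> K n" using unbounded by blast
    define e where "e = (LEAST e. x ^ p ^ e \<in> K n)"
    have "\<exists>e. x ^ p ^ e \<in> K n" using Kinf_exponent x(1) L(3) by blast
    then have e: "x ^ p ^ e \<in> K n" unfolding e_def by (rule LeastI_ex)
    have least: "x ^ p ^ e' \<notin> K n" if "e' < e" for e'
      using that not_less_Least unfolding e_def by blast
    have "2 * Suc r < e"
    proof (rule ccontr)
      assume "\<not> 2 * Suc r < e"
      then have "x ^ p ^ (2 * Suc r) = (x ^ p ^ e) ^ p ^ (2 * Suc r - e)"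
        unfolding pow_add[symmetric] by simp
      then show False using x(2) sf_power[OF subfield_K e] by simp
    qed
    then obtain t where t: "e = Suc r + t" "Suc r < t" using less_imp_add_positive by (metis
      add_less_cancel_left le_add_diff_inverse less_imp_le mult_2 le_add1 order.strict_trans1)
    define y where "y = x ^ p ^ t"
    have "x \<in> M n e" using exponent_bound e x(1) L(3) by blast
    then have "y \<in> U n (Suc r)" unfolding y_def by (rule M_power) (use t in auto)
    then have "y \<in> gen (U n r \<union> {T (Suc r) (Suc n)})" using U_Suc by blast
    moreover have "y \<in> L" unfolding y_def by (rule sf_power[OF L(1) x(1)])
    moreover have "y \<notin> U n r"
    proof
      assume "y \<in> U n r"
      then have "x ^ p ^ (t + r) \<in> K n" unfolding y_def pow_add by (rule U_exponent)
      then show False using least[of "t + r"] t(1) by simp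
    qed
    ultimately have "T (Suc r) (Suc n) \<in> L"
      using generator_recovered[OF subfield_U L(1) Suc.IH first_row_pow] by blast
    then have "gen (U n r \<union> {T (Suc r) (Suc n)}) \<subseteq> L"
      using Suc.IH by (intro gen_least L) auto
    then show ?case using U_Suc by blast
  qed
  have K0: "K 0 \<subseteq> L" using K_mono[of 0 n] L(2) by blast
  show ?thesis
    unfolding K_def
  proof (rule gen_least[OF L(1)], intro Un_least subsetI)
    fix s assume "s \<in> {T i j |i j. 1 \<le> i \<and> 1 \<le> j \<and> j \<le> Suc n}"
    then obtain i j where s: "s = T i j" "1 \<le> i" "1 \<le> j" "j \<le> Suc n" by blast
    show "s \<in> L"
    proof (cases "j = Suc n")
      case True
      then show ?thesis using T_in_U[of i i n] U s by auto
    next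
      case False
      then show ?thesis using T_in_K[of i j n] L(2) s by auto
    qed
  next
    show "s \<in> L" if "s \<in> Q" for s using that K_base(1)[of 0] K0 by blast
    show "s \<in> L" if "s \<in> val ` indets" for s using that K_base(2)[of _ 0] K0 by blast
  qed
qed

lemma intermediate_bounded:
  assumes L: "subfield L ambient" "K 0 \<subseteq> L" "L \<subseteq> Kinf" "L \<noteq> Kinf"
  obtains n s where "K n \<subseteq> L" "\<forall>x\<in>L. x ^ p ^ s \<in> K n"
proof -
  have "\<not> (\<forall>n. K n \<subseteq> L)" using L(3,4) unfolding Kinf_def by blast
  moreover have "K m \<subseteq> L" if "\<And>n. K n \<subseteq> L \<Longrightarrow> K (Suc n) \<subseteq> L" for m
    by (induction m) (use L(2) that in simp_all)
  ultimately have "\<exists>n. K n \<subseteq> L \<and> \<not> K (Suc n) \<subseteq> L" by blast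
  then obtain n where n: "K n \<subseteq> L" "\<not> K (Suc n) \<subseteq> L" by blast
  then show ?thesis using unbounded_absorbs[OF L(1) n(1) L(3)] that by blast
qed

lemma finite_generators: "finite {T i j |i j. 1 \<le> i \<and> n < j \<and> weight n i j \<le> m}"
proof (rule finite_subset)
  show "{T i j |i j. 1 \<le> i \<and> n < j \<and> weight n i j \<le> m} \<subseteq> (\<lambda>(i, j). T i j) ` ({..m} \<times> {..n + m})"
  proof
    fix x assume "x \<in> {T i j |i j. 1 \<le> i \<and> n < j \<and> weight n i j \<le> m}"
    then obtain i j where x: "x = T i j" "1 \<le> i" "n < j" "weight n i j \<le> m" by blast
    have "j - Suc n < 2 ^ (j - Suc n)" by (rule less_exp)
    also have "\<dots> \<le> weight n i j" using x(2) by (simp add: weight_def)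
    finally have "j \<le> n + m" using x(4) by simp
    moreover have "i \<le> weight n i j" by (simp add: weight_def)
    ultimately show "x \<in> (\<lambda>(i, j). T i j) ` ({..m} \<times> {..n + m})" using x by force
  qed
qed simp

lemma roots_finitely_generated:
  assumes L: "subfield L ambient" "K 0 \<subseteq> L" "L \<subseteq> Kinf" "L \<noteq> Kinf"
  obtains S where "finite S" "{x \<in> Kinf. x ^ p ^ m \<in> L} \<subseteq> gen (L \<union> S)"
proof -
  obtain n s where n: "K n \<subseteq> L" "\<forall>x\<in>L. x ^ p ^ s \<in> K n"
    using intermediate_bounded[OF L] .
  have "x \<in> M n (m + s)" if "x \<in> Kinf" "x ^ p ^ m \<in> L" for x
    using exponent_bound[OF that(1), of "m + s" n] n(2) that(2) by (simp add: pow_add)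
  moreover have "M n (m + s) \<subseteq> gen (L \<union> {T i j |i j. 1 \<le> i \<and> n < j \<and> weight n i j \<le> m + s})"
    unfolding M_def using n(1) by (intro gen_mono) blast
  ultimately show ?thesis using that[OF finite_generators] by blast
qed

lemma K_Suc: "(\<Union>i\<in>{1..}. gen (K n \<union> {T i (Suc n)})) = K (Suc n)"
proof
  have "gen (K n \<union> {T i (Suc n)}) \<subseteq> K (Suc n)" if "1 \<le> i" for i
    using T_in_K[OF that, of "Suc n" "Suc n"] K_mono[of n "Suc n"]
    by (intro gen_least subfield_K) auto
  then show "(\<Union>i\<in>{1..}. gen (K n \<union> {T i (Suc n)})) \<subseteq> K (Suc n)" by auto
  define G where "G = (\<lambda>i. gen (K n \<union> {T (Suc i) (Suc n)}))"
  have KG: "K n \<subseteq> G i" "T (Suc i) (Suc n) \<in> G i" for i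
    unfolding G_def using gen_incl[of "K n \<union> {T (Suc i) (Suc n)}"] by auto
  have "T (Suc i) (Suc n) \<in> G (Suc i)" for i
  proof (rule T_pred_in)
    show "T (2 * Suc (Suc i)) (Suc n - 1) \<in> G (Suc i)" if "2 \<le> Suc n"
      using T_in_K[of "2 * Suc (Suc i)" n n] KG(1)[of "Suc i"] that by auto
    show "K 0 \<subseteq> G (Suc i)" using K_mono[of 0 n] KG(1) by blast
  qed (use KG gen_subfield in \<open>auto simp: G_def\<close>)
  then have "gen (K n \<union> {T (Suc i) (Suc n)}) \<subseteq> G (Suc i)" for i
    using KG(1) by (intro gen_least) (auto simp: G_def gen_subfield)
  then have "G i \<subseteq> G (Suc i)" for i
    by (simp add: G_def)
  then have G: "subfield (\<Union>i. G i) ambient"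
    by (intro sf_UN_chain) (auto simp: G_def gen_subfield)
  have "K (Suc n) \<subseteq> (\<Union>i. G i)"
    unfolding K_def[of "Suc n"]
  proof (rule gen_least[OF G], intro Un_least subsetI)
    fix s assume "s \<in> {T i j |i j. 1 \<le> i \<and> 1 \<le> j \<and> j \<le> Suc n}"
    then obtain i j where s: "s = T i j" "1 \<le> i" "1 \<le> j" "j \<le> Suc n" by blast
    show "s \<in> (\<Union>i. G i)"
    proof (cases "j = Suc n")
      case True
      then have "s \<in> G (i - 1)" using KG(2)[of "i - 1"] s by simp
      then show ?thesis by blast
    next
      case False
      then show ?thesis using T_in_K[of i j n] KG(1) s by fastforce
    qed
  next
    show "s \<in> (\<Union>i. G i)" if "s \<in> Q" for s using that K_base(1)[of n] KG(1) by blast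
    show "s \<in> (\<Union>i. G i)" if "s \<in> val ` indets" for s using that K_base(2)[of _ n] KG(1) by blast
  qed
  moreover have "G i \<subseteq> (\<Union>i\<in>{1..}. gen (K n \<union> {T i (Suc n)}))" for i
    unfolding G_def by (rule UN_upper) simp
  ultimately show "K (Suc n) \<subseteq> (\<Union>i\<in>{1..}. gen (K n \<union> {T i (Suc n)}))" by blast
qed

end

section \<open>Roots and finite extensions inside an algebraic closure\<close>

lemma ambient_pow: "x [^]\<^bsub>ambient\<^esub> n = x ^ n" for x :: "'a::field" and n :: nat
proof -
  interpret A: field "ambient :: 'a ring" by (rule field_from_type_algebra)
  show ?thesis by (induction n) (auto simp: ring_of_type_algebra_def mult.commute)
qed

lemma algebraic_closure_root:
  fixes x :: "'a::field"
  assumes "algebraic_closure (ambient :: 'a ring) k" and q: "q > 0"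
  shows "\<exists>y. y ^ q = x"
proof -
  interpret A: algebraic_closure "ambient :: 'a ring" k by fact
  have op: "carrier ambient = (UNIV :: 'a set)" "\<zero>\<^bsub>ambient\<^esub> = (0::'a)" "\<one>\<^bsub>ambient\<^esub> = (1::'a)"
    "u \<oplus>\<^bsub>ambient\<^esub> v = u + v" "u \<otimes>\<^bsub>ambient\<^esub> v = u * v" for u v :: 'a
    by (simp_all add: ring_of_type_algebra_def)
  define P where "P = (1::'a) # replicate (q - 1) 0 @ [- x]"
  have P: "P \<in> carrier (poly_ring ambient)"
    unfolding sym[OF univ_poly_carrier] polynomial_def by (simp add: P_def op)
  have "A.splitted P" by (rule A.roots_over_carrier[OF P])
  then have "size (A.roots P) = q"
    using q unfolding A.splitted_def by (simp add: P_def)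
  then obtain y where "y \<in># A.roots P" using q by (metis size_eq_Suc_imp_elem gr0_implies_Suc)
  then have "A.eval P y = 0"
    using A.roots_mem_iff_is_root[OF P] unfolding A.is_root_def by (simp add: op)
  then have "y ^ q - x = 0"
    using q A.eval_replicate[of "[- x]" y "q - 1"]
    by (simp add: P_def op ambient_pow)
  then show ?thesis by auto
qed

lemma (in char_p) pp_root_pow:
  fixes x :: 'a
  assumes "algebraic_closure (ambient :: 'a ring) k"
  shows "pp_root p n x ^ p ^ n = x"
proof -
  obtain y where y: "y ^ p ^ n = x"
    using algebraic_closure_root[OF assms, of "p ^ n" x] p_pos by auto
  have "\<exists>!y. y ^ p ^ n = x"
    using y frob_inj by blast
  then show ?thesis unfolding pp_root_def by (rule theI')
qed

lemma finite_dimension_subfield: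
  fixes L V :: "'a::field set"
  assumes closure: "algebraic_closure (ambient :: 'a ring) k" and L: "subfield L ambient" "k \<subseteq> L"
    and V: "subfield V ambient" "L \<subseteq> V" "V \<subseteq> gen (L \<union> S)" and S: "finite S"
  shows "ring.finite_dimension ambient L V"
proof -
  interpret A: algebraic_closure "ambient :: 'a ring" k by fact
  have car: "carrier ambient = (UNIV :: 'a set)" by (simp add: ring_of_type_algebra_def)
  obtain xs where xs: "set xs = S" using S finite_list by blast
  have alg: "(A.algebraic over L) x" for x
    using A.algebraic_extension[of x] A.algebraic_mono[OF L(2)] by (simp add: car)
  have sub: "set xs \<subseteq> carrier ambient" by (simp add: car)
  have fin: "A.finite_dimension L (A.finite_extension L xs)"
    by (rule A.finite_extension_finite_dimension(1)[OF L(1) sub alg])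
  have "gen (L \<union> S) \<subseteq> A.finite_extension L xs"
  proof (rule gen_least)
    show "subfield (A.finite_extension L xs) ambient"
      by (rule A.finite_extension_is_subfield[OF L(1) sub alg])
    show "L \<union> S \<subseteq> A.finite_extension L xs"
      using A.finite_extension_incl[OF _ sub, of L] A.finite_extension_mem[OF subfieldE(1)[OF L(1)] sub]
        xs by (simp add: car)
  qed
  moreover have "subalgebra L V ambient"
  proof (intro subalgebra.intro subalgebra_axioms.intro)
    show "subgroup V (add_monoid ambient)"
      using subring.axioms(1)[OF subfieldE(1)[OF V(1)]] .
    show "u \<otimes>\<^bsub>ambient\<^esub> v \<in> V" if "u \<in> L" "v \<in> V" for u v
      using that V(2) sf_mult[OF V(1), of u v] by (auto simp: ring_of_type_algebra_def)
  qed
  ultimately show ?thesis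
    using A.subalbegra_incl_imp_finite_dimension[OF L(1) fin] V(3) by blast
qed

theorem mainTheorem10:
  fixes Q k K :: "'a::field set"
    and X0 :: 'a
    and Z Y :: "nat \<Rightarrow> nat \<Rightarrow> 'a"
    and a :: "nat \<Rightarrow> 'a"
    and p :: nat
  assumes "p > 0" and "CHAR('a) = p"
    and "perfect_subfield p Q"
    and "algebraically_independent Q indets (indet_value X0 Z Y)"
    and "k = base_field Q X0 Z Y"
    and "algebraic_closure (ambient :: 'a ring) k"
    and "\<And>n. n \<ge> 1 \<Longrightarrow> a n \<in> perfect_hull_X p Q X0"
    and "\<And>n. n \<ge> 1 \<Longrightarrow> adjoin Q {a n} = adjoin Q {pp_root p n X0}"
    and "K = tower_union k p a Z Y"
  shows "absolutely_lq_finite p k K"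
proof -
  interpret C: char_p p "TYPE('a)" by standard (fact assms(1) assms(2))+
  have root: "pp_root p n x ^ p ^ n = x" for n and x :: 'a
    by (rule C.pp_root_pow[OF assms(6)])
  have root1: "pp_root p 1 x ^ p = x" for x :: 'a
    using root[of 1 x] by simp
  have T0: "theta p a Z Y 0 j = 0" if "2 \<le> j" for j
    using that by (cases j; cases "j - 1") auto
  interpret T: tower_construction p "TYPE('a)" Q X0 Z Y "\<lambda>i. pp_root p i X0" "theta p a Z Y"
  proof (intro tower_construction.intro tower_construction_axioms.intro
      independent_family.intro independent_family_axioms.intro)
    show "char_p TYPE('a) p" by (rule C.char_p_axioms)
    show "subfield Q ambient" using assms(3) by (simp add: perfect_subfield_def)
    show "algebraically_independent Q indets (indet_value X0 Z Y)" by fact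
    show "pp_root p i X0 ^ p ^ i = X0" for i by (rule root)
    show "gen (Q \<union> {theta p a Z Y i 1}) = gen (Q \<union> {pp_root p i X0})" if "1 \<le> i" for i
      using assms(8)[OF that] by simp
    show "theta p a Z Y i j ^ p
        = Z i j * theta p a Z Y (2 * i) (j - 1) ^ p + theta p a Z Y (i - 1) j + Y i j"
      if "1 \<le> i" "2 \<le> j" for i j
    proof (cases "i = 1")
      case True
      then show ?thesis
        using that(2) T0[OF that(2)]
        by (simp add: theta_1[unfolded One_nat_def] C.frob_add1 power_mult_distrib root1[unfolded One_nat_def])
    next
      case False
      then show ?thesis
        using that theta_rec[of j i p a Z Y]
        by (simp add: C.frob_add1 power_mult_distrib root1[unfolded One_nat_def])
    qed
  qed (rule T0)
  have k: "k = T.K 0"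
  proof -
    have "{theta p a Z Y i j |i j. 1 \<le> i \<and> 1 \<le> j \<and> j \<le> 0} = {}" by auto
    then show ?thesis unfolding assms(5) base_field_def T.K_def by simp
  qed
  have tower: "tower k p a Z Y n = T.K n" for n
    by (induction n) (simp_all only: tower.simps k T.K_Suc)
  have K: "K = T.Kinf"
  proof -
    have "T.K 0 \<subseteq> T.K 1" by (rule T.K_mono) simp
    then have "T.K n \<subseteq> (\<Union>n\<in>{1..}. T.K n)" for n
      by (cases n) force+
    then have "(\<Union>n\<in>{1..}. T.K n) = (\<Union>n. T.K n)" by blast
    then show ?thesis by (simp add: assms(9) tower_union_def tower T.Kinf_def)
  qed
  have "lq_finite p L K" if L: "subfield L ambient" "k \<subseteq> L" "L \<subseteq> K" for L
  proof -
    have "purely_inseparable p L K"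
      unfolding purely_inseparable_def
      using L T.Kinf_exponent[of _ 0] T.subfield_Kinf unfolding K k by blast
    moreover have "ring.finite_dimension ambient L {x \<in> K. x ^ p ^ n \<in> L}" for n
    proof -
      have eq: "{x \<in> K. x ^ p ^ n \<in> L} = T.Kinf \<inter> {x. x ^ p ^ n \<in> L}" by (auto simp: K)
      have V: "subfield {x \<in> K. x ^ p ^ n \<in> L} ambient"
        unfolding eq by (intro sf_Int T.subfield_Kinf C.sf_root L)
      have LV: "L \<subseteq> {x \<in> K. x ^ p ^ n \<in> L}"
        using L by (auto intro: sf_power)
      obtain S where "finite S" "{x \<in> K. x ^ p ^ n \<in> L} \<subseteq> gen (L \<union> S)"
      proof (cases "L = K")
        case True
        then show ?thesis using that[of "{}"] gen_incl[of L] by auto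
      next
        case False
        then show ?thesis
          using T.roots_finitely_generated[of L n] L that by (auto simp: K k)
      qed
      then show ?thesis
        using finite_dimension_subfield[OF assms(6) L(1,2) V LV] by blast
    qed
    ultimately show ?thesis by (simp add: lq_finite_def)
  qed
  then show ?thesis by (simp add: absolutely_lq_finite_def)
qed

end
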